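(* Let $X$ be a CAT(0) space with basepoint $\mathfrak{o}$ and let $\kappa$ be a sublinear function. A geodesic ray $b$ in $X$ (with $b(0)=\mathfrak{o}$) is $\kappa$-contracting if and only if there exists $C>0$ such that $b$ meets an infinite chain of curtains $\{h_i\}_{i\ge1}$ at points $b(t_i)\in h_i$ satisfying, for all $i$: \begin{itemize} \item $t_{i+1}-t_i\le C\kappa(t_{i+1})$; \item $h_i$ and $h_{i+1}$ are $C\kappa(t_{i+1})$-separated. \end{itemize}
   Context: **Sublinear functions.** A sublinear function is $\kappa:[0,\infty)\to[1,\infty)$ with $\lim_{t\to\infty}\kappa(t)/t=0$; by convention $\kappa$ is monotone increasing (constants allowed) and concave. For $x\in X$, $\kappa(x):=\kappa(d(\mathfrak{o},x))$. **$\kappa$-contracting.** With $\pi_b$ the closest point projection to $b$, the geodesic ray $b$ is $\kappa$-contracting if there is $C\ge0$ such that for every $x\in X$ and every ball $B$ centered at $x$ with $B\cap b=\emptyset$ one has $\operatorname{diam}(\pi_b(B))<C\kappa(x)$. **Curtains.** Let $a:I\to X$ be a geodesic, $\pi_a$ the closest point projection to $a$, and $r$ a number with $[r-\frac12,r+\frac12]$ in the interior of $I$. The curtain dual to $a$ at $r$ is $h=h_{a,r}=\pi_a^{-1}(a([r-\frac12,r+\frac12]))$; its half spaces $h^-$ and $h^+$ are the preimages under $\pi_a$ of the parts of $a$ before $r-\frac12$ and after $r+\frac12$. A curtain $h$ separates $A,B\subset X$ if one of $A,B$ lies in $h^-$ and the other in $h^+$. A set $\{h_i\}$ of curtains is a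 chain if the $h_i$ are pairwise disjoint and $h_i$ separates $h_{i-1}$ from $h_{i+1}$ for all $i$. A chain meets a set if each of its curtains intersects it. For $L\ge0$ disjoint curtains $h,h'$ are $L$-separated if every chain meeting both $h$ and $h'$ has cardinality at most $L$. The curtains in the chain of the theorem need not be dual to $b$. *)

theory Defs
  imports "HOL-Analysis.Analysis"
begin

context metric_space
begin

text \<open>
  Domains of geodesics are closed intervals (bounded or not), so that every point of a
  CAT(0) space, complete or not, has a closest point on the image.
\<close>

definition geodesic_on :: "real set \<Rightarrow> (real \<Rightarrow> 'a) \<Rightarrow> bool" where
  "geodesic_on I a \<longleftrightarrow>
     is_interval I \<and> closed I \<and> (\<forall>s\<in>I. \<forall>t\<in>I. dist (a s) (a t) = \<bar>s - t\<bar>)"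

definition geodesic_joining :: "(real \<Rightarrow> 'a) \<Rightarrow> 'a \<Rightarrow> 'a \<Rightarrow> bool" where
  "geodesic_joining c p q \<longleftrightarrow>
     geodesic_on {0..dist p q} c \<and> c 0 = p \<and> c (dist p q) = q"

definition closest_proj :: "'a set \<Rightarrow> 'a \<Rightarrow> 'a" where
  "closest_proj S x = (THE p. p \<in> S \<and> (\<forall>y\<in>S. dist x p \<le> dist x y))"

end

text \<open>
  CAT(0) spaces: geodesic metric spaces whose geodesic triangles are no fatter than their
  comparison triangles \<open>p' q' r'\<close> in the Euclidean plane. It is enough to take \<open>x\<close> and \<open>y\<close>
  on the two sides issuing from \<open>p\<close>: two different sides always share a vertex, any vertex
  may be called \<open>p\<close>, and for two points on the same side the inequality is an equality.
  Completeness is not assumed.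
\<close>

class cat0_space = metric_space +
  assumes ex_geodesic: "\<exists>c. geodesic_joining c p q"
    and cat0_comparison:
      "\<lbrakk>geodesic_joining c p q; geodesic_joining c' p r;
        x \<in> c ` {0..dist p q}; y \<in> c' ` {0..dist p r};
        dist p' q' = dist p q; dist p' r' = dist p r; dist q' r' = dist q r;
        x' \<in> closed_segment p' q'; dist p' x' = dist p x;
        y' \<in> closed_segment p' r'; dist p' y' = dist p y\<rbrakk>
       \<Longrightarrow> dist x y \<le> dist x' (y' :: real ^ 2)"

definition sublinear_fun :: "(real \<Rightarrow> real) \<Rightarrow> bool" where
  "sublinear_fun \<kappa> \<longleftrightarrow>
     (\<forall>t\<ge>0. 1 \<le> \<kappa> t) \<and> mono_on {0..} \<kappa> \<and> concave_on {0..} \<kappa> \<and>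
     ((\<lambda>t. \<kappa> t / t) \<longlongrightarrow> 0) at_top"

text \<open>The point \<open>o'\<close> is the basepoint, and \<open>b\<close> is a geodesic ray with domain \<open>{0..}\<close>.\<close>

definition contracting :: "'a::metric_space \<Rightarrow> (real \<Rightarrow> real) \<Rightarrow> (real \<Rightarrow> 'a) \<Rightarrow> bool" where
  "contracting o' \<kappa> b \<longleftrightarrow>
     (\<exists>C\<ge>0. \<forall>x. \<forall>\<rho>>0. ball x \<rho> \<inter> b ` {0..} = {} \<longrightarrow>
        diameter (closest_proj (b ` {0..}) ` ball x \<rho>) < C * \<kappa> (dist o' x))"

definition curtain_data :: "real set \<Rightarrow> (real \<Rightarrow> 'a::metric_space) \<Rightarrow> real \<Rightarrow> bool" where
  "curtain_data I a r \<longleftrightarrow> geodesic_on I a \<and> {r - 1/2..r + 1/2} \<subseteq> interior I"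

definition dual_curtain :: "real set \<Rightarrow> (real \<Rightarrow> 'a::metric_space) \<Rightarrow> real \<Rightarrow> 'a set" where
  "dual_curtain I a r = closest_proj (a ` I) -` (a ` {r - 1/2..r + 1/2})"

definition half_minus :: "real set \<Rightarrow> (real \<Rightarrow> 'a::metric_space) \<Rightarrow> real \<Rightarrow> 'a set" where
  "half_minus I a r = closest_proj (a ` I) -` (a ` (I \<inter> {..<r - 1/2}))"

definition half_plus :: "real set \<Rightarrow> (real \<Rightarrow> 'a::metric_space) \<Rightarrow> real \<Rightarrow> 'a set" where
  "half_plus I a r = closest_proj (a ` I) -` (a ` (I \<inter> {r + 1/2<..}))"

definition is_curtain :: "'a::metric_space set \<Rightarrow> bool" where
  "is_curtain h \<longleftrightarrow> (\<exists>I a r. curtain_data I a r \<and> h = dual_curtain I a r)"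

text \<open>
  The same subset may be dual to several geodesics. In a CAT(0) space its two half spaces
  are nevertheless determined up to order, being the path components of its complement,
  so the choice of the geodesic below is immaterial.
\<close>

definition separates :: "'a::metric_space set \<Rightarrow> 'a set \<Rightarrow> 'a set \<Rightarrow> bool" where
  "separates h A B \<longleftrightarrow>
     (\<exists>I a r. curtain_data I a r \<and> h = dual_curtain I a r \<and>
        (A \<subseteq> half_minus I a r \<and> B \<subseteq> half_plus I a r \<or>
         A \<subseteq> half_plus I a r \<and> B \<subseteq> half_minus I a r))"

text \<open>
  Chains are indexed by a set \<open>J\<close> of consecutive integers, which may be finite, infinite in
  one direction, or all of the integers.
\<close>

definition curtain_chain :: "int set \<Rightarrow> (int \<Rightarrow> 'a::metric_space set) \<Rightarrow> bool" where
  "curtain_chain J h \<longleftrightarrow>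
     (\<forall>i\<in>J. \<forall>k\<in>J. {i..k} \<subseteq> J) \<and>
     (\<forall>i\<in>J. is_curtain (h i)) \<and>
     disjoint_family_on h J \<and>
     (\<forall>i. i - 1 \<in> J \<and> i \<in> J \<and> i + 1 \<in> J \<longrightarrow> separates (h i) (h (i - 1)) (h (i + 1)))"

definition chain_meets :: "int set \<Rightarrow> (int \<Rightarrow> 'a::metric_space set) \<Rightarrow> 'a set \<Rightarrow> bool" where
  "chain_meets J h A \<longleftrightarrow> (\<forall>i\<in>J. h i \<inter> A \<noteq> {})"

definition L_separated :: "real \<Rightarrow> 'a::metric_space set \<Rightarrow> 'a set \<Rightarrow> bool" where
  "L_separated L h h' \<longleftrightarrow>
     is_curtain h \<and> is_curtain h' \<and> h \<inter> h' = {} \<and>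
     (\<forall>J g. curtain_chain J g \<and> chain_meets J g h \<and> chain_meets J g h' \<longrightarrow>
        finite (g ` J) \<and> real (card (g ` J)) \<le> L)"

end

theory Submission
  imports Defs
begin

text \<open>
  Suppose that \<open>b\<close> is contracting, let \<open>\<Delta>\<close> be a large multiple of \<open>\<kappa> T\<close> and \<open>\<rho> = 24 * \<Delta>\<close>. Two points at
  height \<open>\<rho>\<close> over \<open>b\<close> whose projections are \<open>\<Delta>\<close> apart (near \<open>b T\<close>) are \<open>2 * \<rho>\<close> apart, because the balls
  of radius \<open>\<rho>\<close> around them have disjoint projections. The CAT(0) inequality spreads this to all
  greater heights: \<open>x\<close> and \<open>y\<close> with projections \<open>\<Delta>\<close> apart satisfy
  \<open>dist x y \<ge> height x + height y - min (height x) (height y) / 2 - 2 * \<rho>\<close>. Adding this estimate over the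
  two halves of a geodesic whose projection has length \<open>2 * \<Delta>\<close> bounds the height of its middle point
  by \<open>98 * \<Delta>\<close>, however far away its endpoints are. A curtain contains a path of at most three geodesics
  between any two of its points, so every curtain that meets two curtains dual to \<open>b\<close> a multiple of
  \<open>\<kappa> T\<close> apart comes close to \<open>b\<close> between them, and a chain of such curtains is short.

  Conversely, let \<open>x\<close> and \<open>y\<close> have projections far apart relative to \<open>\<kappa>\<close>, and take five consecutive
  curtains of the given chain meeting \<open>b\<close> halfway. If \<open>x\<close> were beyond two of them, these two would
  be met by a long chain of curtains dual to \<open>b\<close>; similarly for \<open>y\<close>. Hence \<open>[x, y]\<close> crosses the three
  middle ones, and a bottleneck argument brings it close to \<open>b\<close>, so that
  \<open>dist x y\<close> exceeds the distances of \<open>x\<close> and of \<open>y\<close> from \<open>b\<close>.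
\<close>

section \<open>The CAT(0) inequality\<close>

lemma comparison_triangle_exists:
  fixes a b c :: real
  assumes "0 \<le> a" "0 \<le> b" "a \<le> b + c" "b \<le> a + c" "c \<le> a + b"
  obtains p q r :: "real ^ 2" where "dist p q = a" "dist p r = b" "dist q r = c"
proof (cases "a = 0")
  case True
  have "dist (0 :: real ^ 2) (vector [b, 0]) = b"
    using assms by (simp add: dist_norm norm_vec_def L2_set_def sum_2)
  moreover have "b = c" using assms True by linarith
  ultimately show thesis using that[of 0 0 "vector [b, 0]"] True by simp
next
  case False
  then have a: "a > 0" using assms by simp
  \<comment> \<open>The abscissa of \<open>r\<close> by the law of cosines, with \<open>p\<close> at
    the origin and \<open>q\<close> on the axis. The triangle inequalities amount to
    \<open>\<bar>x\<bar> \<le> b\<close>, which makes the ordinate real.\<close>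
  define x where "x = (a\<^sup>2 + b\<^sup>2 - c\<^sup>2) / (2 * a)"
  have ax: "2 * a * x = a\<^sup>2 + b\<^sup>2 - c\<^sup>2" using a by (simp add: x_def)
  have c0: "0 \<le> c" using assms by linarith
  have "\<bar>a - b\<bar>\<^sup>2 \<le> c\<^sup>2" by (rule power_mono) (use assms in auto)
  moreover have "c\<^sup>2 \<le> (a + b)\<^sup>2" by (rule power_mono) (use assms c0 in auto)
  ultimately have "2 * a * (b - x) \<ge> 0" "2 * a * (b + x) \<ge> 0"
    using ax by (auto simp: algebra_simps power2_eq_square)
  then have "b - x \<ge> 0" "b + x \<ge> 0" using a by (auto simp: zero_le_mult_iff)
  then have "(b - x) * (b + x) \<ge> 0" by simp
  then have y: "b\<^sup>2 - x\<^sup>2 \<ge> 0" by (simp add: algebra_simps power2_eq_square)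
  define y where "y = sqrt (b\<^sup>2 - x\<^sup>2)"
  have y2: "y\<^sup>2 = b\<^sup>2 - x\<^sup>2" using y by (simp add: y_def)
  have 1: "dist (0 :: real ^ 2) (vector [a, 0]) = a"
    using a by (simp add: dist_norm norm_vec_def L2_set_def sum_2)
  have 2: "dist (0 :: real ^ 2) (vector [x, y]) = b"
    using assms y2 by (simp add: dist_norm norm_vec_def L2_set_def sum_2)
  have "(a - x)\<^sup>2 + y\<^sup>2 = c\<^sup>2" using y2 ax by (simp add: algebra_simps power2_eq_square)
  then have 3: "dist (vector [a, 0] :: real ^ 2) (vector [x, y]) = c"
    using c0 by (simp add: dist_norm norm_vec_def L2_set_def sum_2)
  show thesis using that 1 2 3 by blast
qed

lemma euclidean_stewart:
  fixes p q r :: "'v::real_inner"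
  shows "(dist ((1 - l) *\<^sub>R p + l *\<^sub>R q) r)\<^sup>2 =
    (1 - l) * (dist p r)\<^sup>2 + l * (dist q r)\<^sup>2 - l * (1 - l) * (dist p q)\<^sup>2"
proof -
  have "(norm ((1 - l) *\<^sub>R P + l *\<^sub>R Q))\<^sup>2 =
      (1 - l) * (norm P)\<^sup>2 + l * (norm Q)\<^sup>2 - l * (1 - l) * (norm (P - Q))\<^sup>2" for P Q :: 'v
    unfolding power2_norm_eq_inner
    by (simp add: inner_diff_left inner_diff_right inner_add_left inner_add_right
        inner_commute algebra_simps power2_eq_square)
  from this[of "p - r" "q - r"]
  have "(norm ((1 - l) *\<^sub>R (p - r) + l *\<^sub>R (q - r)))\<^sup>2 =
      (1 - l) * (norm (p - r))\<^sup>2 + l * (norm (q - r))\<^sup>2 - l * (1 - l) * (norm (p - q))\<^sup>2"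
    by simp
  moreover have "(1 - l) *\<^sub>R (p - r) + l *\<^sub>R (q - r) = (1 - l) *\<^sub>R p + l *\<^sub>R q - r"
    by (simp add: algebra_simps)
  ultimately show ?thesis by (simp only: dist_norm)
qed

text \<open>The CAT(0) inequality with one comparison point at the vertex \<open>r'\<close>,
  evaluated by Stewart's identity in the plane. The factor \<open>dist p q\<close> avoids a division
  and so covers \<open>p = q\<close>.\<close>

lemma geodesic_joining_stewart:
  fixes r :: "'a::cat0_space"
  assumes c: "geodesic_joining c p q" and u: "0 \<le> u" "u \<le> dist p q"
  shows "dist p q * (dist r (c u))\<^sup>2 \<le>
    (dist p q - u) * (dist r p)\<^sup>2 + u * (dist r q)\<^sup>2 - dist p q * u * (dist p q - u)"
proof (cases "dist p q = 0")
  case True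
  then show ?thesis using u by simp
next
  case False
  define d where "d = dist p q"
  have d: "d > 0" using False zero_le_dist[of p q] by (simp add: d_def)
  obtain c' where c': "geodesic_joining c' p r" using ex_geodesic by blast
  obtain p' q' r' :: "real ^ 2"
    where e: "dist p' q' = dist p q" "dist p' r' = dist p r" "dist q' r' = dist q r"
    using comparison_triangle_exists[of "dist p q" "dist p r" "dist q r"]
      dist_triangle[of p q r] dist_triangle[of p r q] dist_triangle[of q r p]
    by (auto simp: dist_commute add.commute)
  define l where "l = u / d"
  have l: "0 \<le> l" "l \<le> 1" using u d by (auto simp: l_def d_def)
  define x' where "x' = (1 - l) *\<^sub>R p' + l *\<^sub>R q'"
  have x': "x' \<in> closed_segment p' q'"
    using l by (auto simp: x'_def closed_segment_def)
  have "p' - x' = l *\<^sub>R (p' - q')" by (simp add: x'_def algebra_simps)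
  then have "dist p' x' = l * dist p' q'"
    using l by (simp add: dist_norm)
  then have px': "dist p' x' = u" using e d by (simp add: l_def d_def)
  have "dist (c 0) (c u) = u"
    using c u by (auto simp: geodesic_joining_def geodesic_on_def)
  then have pcu: "dist p (c u) = u" using c by (simp add: geodesic_joining_def)
  have "dist (c u) r \<le> dist x' r'"
  proof (rule cat0_comparison[OF c c'])
    show "c u \<in> c ` {0..dist p q}" using u by auto
    show "r \<in> c' ` {0..dist p r}"
      using c' by (intro image_eqI[of _ _ "dist p r"]) (auto simp: geodesic_joining_def)
    show "dist p' x' = dist p (c u)" using px' pcu by simp
  qed (use e x' in auto)
  then have "(dist r (c u))\<^sup>2 \<le> (dist x' r')\<^sup>2" by (simp add: dist_commute)
  also have "\<dots> = (1 - l) * (dist r p)\<^sup>2 + l * (dist r q)\<^sup>2 - l * (1 - l) * d\<^sup>2"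
    unfolding x'_def euclidean_stewart e by (simp add: d_def dist_commute)
  finally have "d * (dist r (c u))\<^sup>2 \<le>
      d * ((1 - l) * (dist r p)\<^sup>2 + l * (dist r q)\<^sup>2 - l * (1 - l) * d\<^sup>2)"
    using d by simp
  also have "\<dots> = (d - d * l) * (dist r p)\<^sup>2 + d * l * (dist r q)\<^sup>2 - d * (d * l) * (d - d * l)"
    by (simp add: algebra_simps power2_eq_square)
  also have "d * l = u" using d by (simp add: l_def)
  finally show ?thesis by (simp add: d_def)
qed

lemma geodesic_onD:
  "geodesic_on I a \<Longrightarrow> s \<in> I \<Longrightarrow> t \<in> I \<Longrightarrow> dist (a s) (a t) = \<bar>s - t\<bar>"
  by (simp add: geodesic_on_def)

lemma geodesic_on_between:
  "geodesic_on I a \<Longrightarrow> s \<in> I \<Longrightarrow> t \<in> I \<Longrightarrow> s \<le> u \<Longrightarrow> u \<le> t \<Longrightarrow> u \<in> I"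
  unfolding geodesic_on_def is_interval_1 by blast

lemma geodesic_joining_shift:
  assumes a: "geodesic_on I a" and st: "s \<in> I" "t \<in> I" "s \<le> t"
  shows "geodesic_joining (\<lambda>u. a (s + u)) (a s) (a t)"
proof -
  have d: "dist (a s) (a t) = t - s" using geodesic_onD[OF a st(1,2)] st by simp
  show ?thesis
    unfolding geodesic_joining_def d geodesic_on_def
  proof (intro conjI ballI)
    fix v w assume vw: "v \<in> {0..t - s}" "w \<in> {0..t - s}"
    then have "s + v \<in> I" "s + w \<in> I"
      using geodesic_on_between[OF a st(1,2)] by auto
    then show "dist (a (s + v)) (a (s + w)) = \<bar>v - w\<bar>"
      using geodesic_onD[OF a] by fastforce
  qed (auto simp: is_interval_cc)
qed

lemma stewart:
  fixes r :: "'a::cat0_space"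
  assumes a: "geodesic_on I a" and st: "s \<in> I" "t \<in> I" "s \<le> u" "u \<le> t"
  shows "(t - s) * (dist r (a u))\<^sup>2 \<le>
    (t - u) * (dist r (a s))\<^sup>2 + (u - s) * (dist r (a t))\<^sup>2 - (t - s) * (u - s) * (t - u)"
proof -
  have d: "dist (a s) (a t) = t - s" using geodesic_onD[OF a st(1,2)] st by simp
  have "geodesic_joining (\<lambda>u. a (s + u)) (a s) (a t)"
    by (rule geodesic_joining_shift[OF a]) (use st in auto)
  from geodesic_joining_stewart[OF this, of "u - s" r] show ?thesis
    unfolding d using st by (simp add: algebra_simps)
qed

text \<open>Stewart's inequality at the midpoint \<open>m\<close> of the diagonal from
  \<open>x\<close> to \<open>v\<close>, applied to \<open>y\<close> and to \<open>u\<close>; the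
  other diagonal is at most \<open>dist y m + dist u m\<close>.\<close>

lemma quadrilateral_inequality:
  fixes x y u v :: "'a::cat0_space"
  shows "(dist x v)\<^sup>2 + (dist y u)\<^sup>2 \<le> (dist x u)\<^sup>2 + (dist y v)\<^sup>2 + (dist x y)\<^sup>2 + (dist u v)\<^sup>2"
proof -
  obtain c where c: "geodesic_joining c x v" using ex_geodesic by blast
  define d where "d = dist x v"
  define m where "m = c (d / 2)"
  have st: "d * (dist w m)\<^sup>2 \<le> d * ((dist w x)\<^sup>2 / 2 + (dist w v)\<^sup>2 / 2 - d\<^sup>2 / 4)" for w
    using geodesic_joining_stewart[OF c, of "d / 2" w]
    by (simp add: m_def d_def algebra_simps power2_eq_square)
  have st': "(dist w m)\<^sup>2 \<le> (dist w x)\<^sup>2 / 2 + (dist w v)\<^sup>2 / 2 - d\<^sup>2 / 4" for w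
  proof (cases "d = 0")
    case True
    moreover from this have "m = x" using c by (simp add: m_def geodesic_joining_def)
    ultimately show ?thesis by (simp add: d_def)
  next
    case False
    then have "d > 0" using zero_le_dist[of x v] unfolding d_def by linarith
    then show ?thesis using st[of w] by (simp add: mult_le_cancel_left_pos)
  qed
  have "(dist y u)\<^sup>2 \<le> (dist y m + dist u m)\<^sup>2"
    by (rule power_mono) (metis dist_triangle2, simp)
  also have "\<dots> \<le> 2 * (dist y m)\<^sup>2 + 2 * (dist u m)\<^sup>2"
    using zero_le_power2[of "dist y m - dist u m"]
    unfolding power2_eq_square by (simp add: algebra_simps)
  finally show ?thesis using st'[of y] st'[of u] by (simp add: dist_commute d_def)
qed

section \<open>Closest point projection to a geodesic\<close>

text \<open>The parameter of the closest point rather than the point itself: curtains and half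
  spaces become inequalities between reals.\<close>

definition foot :: "real set \<Rightarrow> (real \<Rightarrow> 'a::metric_space) \<Rightarrow> 'a \<Rightarrow> real" where
  "foot I a x = (SOME u. u \<in> I \<and> (\<forall>v\<in>I. dist x (a u) \<le> dist x (a v)))"

locale cat0_geodesic =
  fixes I :: "real set" and a :: "real \<Rightarrow> 'a::cat0_space"
  assumes geodesic: "geodesic_on I a" and nonempty: "I \<noteq> {}"
begin

lemmas dist_geodesic = geodesic_onD[OF geodesic]
lemmas between = geodesic_on_between[OF geodesic]
lemmas stewart = stewart[OF geodesic]

lemma continuous: "continuous_on I a"
  unfolding continuous_on_iff
proof (intro ballI allI impI)
  fix x and e :: real assume "x \<in> I" "0 < e"
  then show "\<exists>d>0. \<forall>x'\<in>I. dist x' x < d \<longrightarrow> dist (a x') (a x) < e"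
    by (intro exI[of _ e]) (auto simp: dist_geodesic dist_real_def)
qed

lemma ex_closest: "\<exists>u\<in>I. \<forall>v\<in>I. dist x (a u) \<le> dist x (a v)"
proof -
  obtain w where w: "w \<in> I" using nonempty by auto
  \<comment> \<open>Parameters further than \<open>2 * dist x (a w)\<close> from \<open>w\<close>
    give points no closer to \<open>x\<close> than \<open>a w\<close>, so a compact piece of the
    possibly unbounded domain suffices.\<close>
  define K where "K = I \<inter> cball w (2 * dist x (a w))"
  have "compact K" unfolding K_def
    using geodesic by (intro closed_Int_compact) (auto simp: geodesic_on_def)
  moreover have "w \<in> K" using w by (simp add: K_def)
  moreover have "continuous_on K (\<lambda>u. dist x (a u))"
    using continuous_on_subset[OF continuous, of K]
    by (intro continuous_intros) (auto simp: K_def)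
  ultimately obtain u where u: "u \<in> K" "\<And>v. v \<in> K \<Longrightarrow> dist x (a u) \<le> dist x (a v)"
    using continuous_attains_inf[of K "\<lambda>u. dist x (a u)"] by auto
  have "dist x (a u) \<le> dist x (a v)" if v: "v \<in> I" for v
  proof (cases "v \<in> K")
    case False
    then have "\<bar>w - v\<bar> > 2 * dist x (a w)" using v by (auto simp: K_def dist_real_def)
    then have "dist (a w) (a v) > 2 * dist x (a w)" using w v by (simp add: dist_geodesic)
    moreover have "dist (a w) (a v) \<le> dist x (a w) + dist x (a v)" by (rule dist_triangle3)
    ultimately have "dist x (a w) \<le> dist x (a v)" by linarith
    then show ?thesis using u(2)[OF \<open>w \<in> K\<close>] by linarith
  qed (use u in auto)
  then show ?thesis using u(1) by (auto simp: K_def)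
qed

lemma foot_in: "foot I a x \<in> I"
  and foot_le: "v \<in> I \<Longrightarrow> dist x (a (foot I a x)) \<le> dist x (a v)"
proof -
  have "\<exists>u. u \<in> I \<and> (\<forall>v\<in>I. dist x (a u) \<le> dist x (a v))" using ex_closest by blast
  from someI_ex[OF this]
  show "foot I a x \<in> I" "v \<in> I \<Longrightarrow> dist x (a (foot I a x)) \<le> dist x (a v)"
    unfolding foot_def by blast+
qed

text \<open>The angle at the closest point is at least \<open>\<pi>/2\<close>.\<close>

lemma obtuse_of_closest:
  assumes u: "u \<in> I" "\<And>v. v \<in> I \<Longrightarrow> dist x (a u) \<le> dist x (a v)" and v: "v \<in> I"
  shows "(dist x (a u))\<^sup>2 + (v - u)\<^sup>2 \<le> (dist x (a v))\<^sup>2"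
proof -
  \<comment> \<open>Here \<open>w\<close> lies the fraction \<open>e\<close> of the way from
    \<open>u\<close> to \<open>v\<close>. Minimality at \<open>u\<close> and Stewart at
    \<open>w\<close> leave, after division by \<open>e\<close>, the claim with a factor
    \<open>1 - e\<close>; then \<open>e\<close> tends to 0.\<close>
  have key: "(dist x (a u))\<^sup>2 + (1 - e) * (v - u)\<^sup>2 \<le> (dist x (a v))\<^sup>2" if e: "0 < e" "e < 1" for e
  proof (cases "u = v")
    case False
    define w where "w = u + e * (v - u)"
    have w: "w \<in> I" and st: "\<bar>v - u\<bar> * (dist x (a w))\<^sup>2 \<le>
      \<bar>v - u\<bar> * ((1 - e) * (dist x (a u))\<^sup>2 + e * (dist x (a v))\<^sup>2 - e * (1 - e) * (v - u)\<^sup>2)"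
    proof -
      consider "u < v" | "v < u" using False by linarith
      then have "w \<in> I \<and> \<bar>v - u\<bar> * (dist x (a w))\<^sup>2 \<le>
        \<bar>v - u\<bar> * ((1 - e) * (dist x (a u))\<^sup>2 + e * (dist x (a v))\<^sup>2 - e * (1 - e) * (v - u)\<^sup>2)"
      proof cases
        case 1
        have *: "e * (v - u) \<le> 1 * (v - u)" by (rule mult_right_mono) (use 1 e in auto)
        have le: "u \<le> w" using 1 e by (simp add: w_def)
        have le: "u \<le> w" "w \<le> v" using * le by (auto simp: w_def)
        have "\<bar>v - u\<bar> = v - u" using 1 by simp
        then show ?thesis
          using between[OF u(1) v le] stewart[OF u(1) v le, of x]
          by (simp add: w_def algebra_simps power2_eq_square)
      next
        case 2
        have "e * (u - v) \<le> 1 * (u - v)" by (rule mult_right_mono) (use 2 e in auto)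
        moreover have "0 \<le> e * (u - v)" using 2 e by simp
        ultimately have le: "v \<le> w" "w \<le> u" by (auto simp: w_def algebra_simps)
        have "\<bar>v - u\<bar> = u - v" using 2 by simp
        then show ?thesis
          using between[OF v u(1) le] stewart[OF v u(1) le, of x]
          by (simp add: w_def algebra_simps power2_eq_square)
      qed
      then show "w \<in> I" "\<bar>v - u\<bar> * (dist x (a w))\<^sup>2 \<le>
        \<bar>v - u\<bar> * ((1 - e) * (dist x (a u))\<^sup>2 + e * (dist x (a v))\<^sup>2 - e * (1 - e) * (v - u)\<^sup>2)"
        by auto
    qed
    have "(dist x (a u))\<^sup>2 \<le> (dist x (a w))\<^sup>2" using u(2)[OF w] by simp
    also have "\<dots> \<le> (1 - e) * (dist x (a u))\<^sup>2 + e * (dist x (a v))\<^sup>2 - e * (1 - e) * (v - u)\<^sup>2"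
      using st False by (simp add: mult_le_cancel_left_pos)
    finally have "e * ((dist x (a u))\<^sup>2 + (1 - e) * (v - u)\<^sup>2) \<le> e * (dist x (a v))\<^sup>2"
      by (simp add: algebra_simps)
    then show ?thesis using e by simp
  qed simp
  have lim: "((\<lambda>e::real. (dist x (a u))\<^sup>2 + (1 - e) * (v - u)\<^sup>2) \<longlongrightarrow>
      (dist x (a u))\<^sup>2 + (1 - 0) * (v - u)\<^sup>2) (at_right 0)"
    by (intro tendsto_intros)
  have "eventually (\<lambda>e::real. e < 1 \<and> 0 < e) (at_right 0)"
    unfolding eventually_at_right_field by (intro exI[of _ 1]) auto
  then have "eventually (\<lambda>e. (dist x (a u))\<^sup>2 + (1 - e) * (v - u)\<^sup>2 \<le> (dist x (a v))\<^sup>2) (at_right 0)"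
    by eventually_elim (use key in auto)
  from tendsto_upperbound[OF lim this] show ?thesis by simp
qed

lemma obtuse: "v \<in> I \<Longrightarrow> (dist x (a (foot I a x)))\<^sup>2 + (v - foot I a x)\<^sup>2 \<le> (dist x (a v))\<^sup>2"
  by (rule obtuse_of_closest) (auto intro: foot_in foot_le)

lemma foot_unique:
  assumes "u \<in> I" "dist x (a u) \<le> dist x (a (foot I a x))"
  shows "foot I a x = u"
proof -
  have "(dist x (a u))\<^sup>2 \<le> (dist x (a (foot I a x)))\<^sup>2" using assms(2) by simp
  then have "(u - foot I a x)\<^sup>2 \<le> 0" using obtuse[OF assms(1), of x] by linarith
  then show ?thesis by simp
qed

lemma foot_eqI: "u \<in> I \<Longrightarrow> (\<And>v. v \<in> I \<Longrightarrow> dist x (a u) \<le> dist x (a v)) \<Longrightarrow> foot I a x = u"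
  by (rule foot_unique) (auto intro: foot_in)

lemma foot_self: "u \<in> I \<Longrightarrow> foot I a (a u) = u"
  by (rule foot_eqI) auto

lemma closest_proj_eq: "closest_proj (a ` I) x = a (foot I a x)"
  unfolding closest_proj_def
proof (rule the_equality)
  show "a (foot I a x) \<in> a ` I \<and> (\<forall>y\<in>a ` I. dist x (a (foot I a x)) \<le> dist x y)"
    using foot_in foot_le by auto
  fix p assume p: "p \<in> a ` I \<and> (\<forall>y\<in>a ` I. dist x p \<le> dist x y)"
  then obtain u where u: "u \<in> I" "p = a u" by auto
  have "foot I a x = u" by (rule foot_eqI) (use p u in auto)
  then show "p = a (foot I a x)" using u by simp
qed

text \<open>Add the two obtuse angle inequalities at the feet and compare with the quadrilateral
  inequality: the squared heights cancel.\<close>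

lemma foot_lipschitz: "\<bar>foot I a x - foot I a y\<bar> \<le> dist x y"
proof -
  let ?u = "foot I a x" and ?v = "foot I a y"
  have "(dist x (a ?u))\<^sup>2 + (?v - ?u)\<^sup>2 \<le> (dist x (a ?v))\<^sup>2"
    "(dist y (a ?v))\<^sup>2 + (?u - ?v)\<^sup>2 \<le> (dist y (a ?u))\<^sup>2"
    using obtuse foot_in by auto
  moreover have "(dist (a ?u) (a ?v))\<^sup>2 = (?v - ?u)\<^sup>2"
    using dist_geodesic[OF foot_in foot_in] by (simp add: power2_commute)
  ultimately have "(?u - ?v)\<^sup>2 \<le> (dist x y)\<^sup>2"
    using quadrilateral_inequality[of x "a ?v" y "a ?u"] by (simp add: power2_commute)
  then show ?thesis by (simp add: abs_le_square_iff[symmetric])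
qed

lemma continuous_foot: "continuous_on S (foot I a)"
  unfolding continuous_on_iff
proof (intro ballI allI impI)
  fix x and e :: real assume "0 < e"
  then show "\<exists>d>0. \<forall>x'\<in>S. dist x' x < d \<longrightarrow> dist (foot I a x') (foot I a x) < e"
    by (intro exI[of _ e]) (auto simp: dist_real_def intro: le_less_trans[OF foot_lipschitz])
qed

text \<open>A point of the geodesic closer to \<open>c u\<close> than the foot would, going through
  \<open>c u\<close>, also be closer to \<open>x\<close>.\<close>

lemma foot_on_perpendicular:
  assumes c: "geodesic_joining c (a (foot I a x)) x" and u: "0 \<le> u" "u \<le> dist x (a (foot I a x))"
  shows "foot I a (c u) = foot I a x" "dist (c u) (a (foot I a x)) = u"
    "dist x (c u) = dist x (a (foot I a x)) - u"
proof -
  let ?p = "a (foot I a x)"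
  have u': "u \<in> {0..dist ?p x}" using u by (simp add: dist_commute)
  have g: "geodesic_on {0..dist ?p x} c" "c 0 = ?p" "c (dist ?p x) = x"
    using c by (auto simp: geodesic_joining_def)
  show 1: "dist (c u) ?p = u" using geodesic_onD[OF g(1) u', of 0] g(2) u by simp
  show 2: "dist x (c u) = dist x ?p - u"
    using geodesic_onD[OF g(1), of "dist ?p x" u] u' g(3) by (simp add: dist_commute)
  show "foot I a (c u) = foot I a x"
  proof (rule foot_eqI)
    fix v assume "v \<in> I"
    then have "dist x ?p \<le> dist x (a v)" by (rule foot_le)
    also have "\<dots> \<le> dist x (c u) + dist (c u) (a v)" by (rule dist_triangle)
    finally show "dist (c u) ?p \<le> dist (c u) (a v)" using 1 2 by linarith
  qed (rule foot_in)
qed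

text \<open>Every point is joined inside its fibre to the geodesic.\<close>

lemma connected_foot_vimage:
  assumes K: "is_interval K" "K \<subseteq> I"
  shows "connected {x. foot I a x \<in> K}"
proof (cases "K = {}")
  case False
  \<comment> \<open>All members contain the image of \<open>K\<close>, which is nonempty here, so
    connectedness passes to their union.\<close>
  define \<C> where "\<C> = {Z. connected Z \<and> a ` K \<subseteq> Z \<and> Z \<subseteq> {x. foot I a x \<in> K}}"
  have conK: "connected (a ` K)"
    using K continuous_on_subset[OF continuous] is_interval_connected
    by (intro connected_continuous_image) auto
  have aK: "a ` K \<subseteq> {x. foot I a x \<in> K}" using K foot_self by auto
  have "\<exists>Z\<in>\<C>. x \<in> Z" if x: "foot I a x \<in> K" for x
  proof -
    let ?p = "a (foot I a x)"
    obtain c where c: "geodesic_joining c ?p x" using ex_geodesic by blast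
    interpret c: cat0_geodesic "{0..dist ?p x}" c
      by standard (use c in \<open>auto simp: geodesic_joining_def\<close>)
    let ?Z = "c ` {0..dist ?p x} \<union> a ` K"
    have "c 0 = ?p" "c (dist ?p x) = x" using c by (auto simp: geodesic_joining_def)
    then have "?p \<in> c ` {0..dist ?p x}" "x \<in> c ` {0..dist ?p x}"
      by (metis atLeastAtMost_iff imageI order_refl zero_le_dist)+
    then have "?p \<in> c ` {0..dist ?p x} \<inter> a ` K" "x \<in> ?Z" using x by auto
    moreover have "connected (c ` {0..dist ?p x})"
      by (rule connected_continuous_image) (use c.continuous in auto)
    ultimately have "connected ?Z" using conK by (intro connected_Un) auto
    moreover have "?Z \<subseteq> {x. foot I a x \<in> K}"
      using aK foot_on_perpendicular(1)[OF c] x by (auto simp: dist_commute)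
    ultimately have "?Z \<in> \<C>" unfolding \<C>_def by blast
    then show ?thesis using \<open>x \<in> ?Z\<close> by (rule rev_bexI)
  qed
  then have "{x. foot I a x \<in> K} \<subseteq> \<Union>\<C>" by blast
  moreover have "\<Union>\<C> \<subseteq> {x. foot I a x \<in> K}" unfolding \<C>_def by blast
  ultimately have "{x. foot I a x \<in> K} = \<Union>\<C>" by (rule equalityI)
  moreover have "connected (\<Union>\<C>)"
  proof (rule connected_Union)
    show "\<Inter>\<C> \<noteq> {}" using False by (auto simp: \<C>_def)
  qed (auto simp: \<C>_def)
  ultimately show ?thesis by simp
qed simp

lemma connected_meets_fibre:
  assumes "connected Z" "x \<in> Z" "y \<in> Z" "foot I a x \<le> r" "r \<le> foot I a y"
  obtains z where "z \<in> Z" "foot I a z = r"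
proof -
  have "is_interval (foot I a ` Z)"
    using connected_continuous_image[OF continuous_foot assms(1)] by (simp add: is_interval_connected_1)
  then have "r \<in> foot I a ` Z" using assms(2-) unfolding is_interval_1 by blast
  then show thesis using that by blast
qed

end

section \<open>Curtains and chains\<close>

context cat0_geodesic
begin

lemma vimage_closest_proj:
  assumes "K \<subseteq> I"
  shows "closest_proj (a ` I) -` (a ` K) = {x. foot I a x \<in> K}"
proof -
  have "a (foot I a x) \<in> a ` K \<longleftrightarrow> foot I a x \<in> K" for x
  proof
    assume "a (foot I a x) \<in> a ` K"
    then obtain k where k: "k \<in> K" "a (foot I a x) = a k" by auto
    then have "k = foot I a x" using dist_geodesic[OF foot_in[of x], of k] assms by auto
    then show "foot I a x \<in> K" using k by simp
  qed simp
  then show ?thesis by (simp add: vimage_def closest_proj_eq)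
qed

lemma half_minus_eq: "half_minus I a r = {x. foot I a x < r - 1/2}"
  unfolding half_minus_def by (subst vimage_closest_proj) (auto simp: foot_in)

lemma half_plus_eq: "half_plus I a r = {x. r + 1/2 < foot I a x}"
  unfolding half_plus_def by (subst vimage_closest_proj) (auto simp: foot_in)

lemma dual_curtain_eq:
  "{r - 1/2..r + 1/2} \<subseteq> I \<Longrightarrow>
    dual_curtain I a r = {x. r - 1/2 \<le> foot I a x \<and> foot I a x \<le> r + 1/2}"
  unfolding dual_curtain_def by (subst vimage_closest_proj) auto

end

section \<open>The two half spaces of a curtain\<close>

lemma curtain_dataD:
  fixes a :: "real \<Rightarrow> 'a::cat0_space"
  assumes "curtain_data I a r"
  shows "cat0_geodesic I a" "{r - 1/2..r + 1/2} \<subseteq> I"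
proof -
  show *: "{r - 1/2..r + 1/2} \<subseteq> I"
    using assms interior_subset[of I] by (auto simp: curtain_data_def)
  have "r \<in> {r - 1/2..r + 1/2}" by simp
  then have "I \<noteq> {}" using * by blast
  then show "cat0_geodesic I a" using assms by (simp add: cat0_geodesic_def curtain_data_def)
qed

text \<open>Each use of \<open>separates\<close> may choose another dual geodesic. This relation
  keeps the two half spaces of a single choice, in either order, so that they can be named
  throughout an argument.\<close>

definition sides :: "'a::metric_space set \<Rightarrow> 'a set \<Rightarrow> 'a set \<Rightarrow> bool" where
  "sides h A B \<longleftrightarrow> (\<exists>I a r. curtain_data I a r \<and> h = dual_curtain I a r \<and>
     (A = half_minus I a r \<and> B = half_plus I a r \<or> A = half_plus I a r \<and> B = half_minus I a r))"

lemma sides_commute: "sides h A B \<Longrightarrow> sides h B A"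
  unfolding sides_def by blast

lemma ex_sides: "is_curtain h \<Longrightarrow> \<exists>A B. sides h A B"
  unfolding is_curtain_def sides_def by blast

lemma separates_iff_sides: "separates h A' B' \<longleftrightarrow> (\<exists>A B. sides h A B \<and> A' \<subseteq> A \<and> B' \<subseteq> B)"
  unfolding separates_def sides_def by blast

lemma sides_cases:
  fixes h :: "'a::cat0_space set"
  assumes "sides h A B"
  obtains I a r where "cat0_geodesic I a" "{r - 1/2..r + 1/2} \<subseteq> I"
    "h = {x. r - 1/2 \<le> foot I a x \<and> foot I a x \<le> r + 1/2}"
    "A = {x. foot I a x < r - 1/2} \<and> B = {x. r + 1/2 < foot I a x} \<or>
     A = {x. r + 1/2 < foot I a x} \<and> B = {x. foot I a x < r - 1/2}"
proof -
  obtain I a r where *: "curtain_data I a r" "h = dual_curtain I a r"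
    "A = half_minus I a r \<and> B = half_plus I a r \<or> A = half_plus I a r \<and> B = half_minus I a r"
    using assms unfolding sides_def by blast
  interpret cat0_geodesic I a using curtain_dataD[OF *(1)] by simp
  show thesis
    using that[of I a r] * curtain_dataD[OF *(1)]
    unfolding dual_curtain_eq[OF curtain_dataD(2)[OF *(1)]] half_minus_eq half_plus_eq by blast
qed

text \<open>All three sets are preimages of intervals of parameters under the foot map, and
  \<open>connected_foot_vimage\<close> applies to these. The claim on \<open>A\<close> also serves
  for \<open>B\<close> through \<open>sides_commute\<close>.\<close>

lemma
  fixes h :: "'a::cat0_space set"
  assumes "sides h A B"
  shows sides_cover: "A \<union> h \<union> B = UNIV"
    and sides_disjoint: "A \<inter> h = {}" "B \<inter> h = {}" "A \<inter> B = {}"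
    and sides_nonempty: "h \<noteq> {}"
    and sides_connected: "connected h"
    and sides_connected_Un: "connected (A \<union> h)"
proof -
  obtain I a r where *: "cat0_geodesic I a" "{r - 1/2..r + 1/2} \<subseteq> I"
    "h = {x. r - 1/2 \<le> foot I a x \<and> foot I a x \<le> r + 1/2}"
    "A = {x. foot I a x < r - 1/2} \<and> B = {x. r + 1/2 < foot I a x} \<or>
     A = {x. r + 1/2 < foot I a x} \<and> B = {x. foot I a x < r - 1/2}"
    using sides_cases[OF assms] .
  interpret cat0_geodesic I a by fact
  show "A \<union> h \<union> B = UNIV" "A \<inter> h = {}" "B \<inter> h = {}" "A \<inter> B = {}" using *(3,4) by auto
  have "r \<in> I" using *(2) by auto
  then have "a r \<in> h" using foot_self[of r] *(3) by simp
  then show "h \<noteq> {}" by blast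
  have "connected {x. foot I a x \<in> {r - 1/2..r + 1/2}}"
    by (rule connected_foot_vimage) (use * in \<open>auto simp: is_interval_cc\<close>)
  then show "connected h" using *(3) by simp
  have "is_interval I" using geodesic by (simp add: geodesic_on_def)
  then have "is_interval (I \<inter> {..r + 1/2})" "is_interval (I \<inter> {r - 1/2..})"
    unfolding is_interval_1 by auto
  then have "connected {x. foot I a x \<in> I \<inter> {..r + 1/2}}"
    "connected {x. foot I a x \<in> I \<inter> {r - 1/2..}}"
    by (auto intro!: connected_foot_vimage simp del: Int_iff)
  moreover have "A \<union> h = {x. foot I a x \<in> I \<inter> {..r + 1/2}} \<or>
      A \<union> h = {x. foot I a x \<in> I \<inter> {r - 1/2..}}"
    using *(3,4) by (auto simp: foot_in)
  ultimately show "connected (A \<union> h)" by auto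
qed

lemma sides_cross:
  fixes h :: "'a::cat0_space set"
  assumes "sides h A B" "connected Z" "Z \<inter> A \<noteq> {}" "Z \<inter> B \<noteq> {}"
  shows "Z \<inter> h \<noteq> {}"
proof -
  obtain I a r where *: "cat0_geodesic I a" "{r - 1/2..r + 1/2} \<subseteq> I"
    "h = {x. r - 1/2 \<le> foot I a x \<and> foot I a x \<le> r + 1/2}"
    "A = {x. foot I a x < r - 1/2} \<and> B = {x. r + 1/2 < foot I a x} \<or>
     A = {x. r + 1/2 < foot I a x} \<and> B = {x. foot I a x < r - 1/2}"
    using sides_cases[OF assms(1)] .
  interpret cat0_geodesic I a by fact
  have "\<exists>x\<in>Z. \<exists>y\<in>Z. foot I a x < r - 1/2 \<and> r + 1/2 < foot I a y"
    using assms(3,4) *(4) by blast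
  then obtain x y where "x \<in> Z" "y \<in> Z" "foot I a x \<le> r" "r \<le> foot I a y" by force
  then obtain z where "z \<in> Z" "foot I a z = r" using connected_meets_fibre[OF assms(2)] by blast
  then show ?thesis using *(3) by auto
qed

lemma sides_connected_cases:
  fixes h :: "'a::cat0_space set"
  assumes "sides h A B" "connected Z" "Z \<inter> h = {}"
  shows "Z \<subseteq> A \<or> Z \<subseteq> B"
  using sides_cross[OF assms(1,2)] sides_cover[OF assms(1)] assms(3) by blast

lemma connected_geodesic_image:
  fixes c :: "real \<Rightarrow> 'a::cat0_space"
  assumes "geodesic_joining c x y"
  shows "connected (c ` {0..dist x y})" "x \<in> c ` {0..dist x y}" "y \<in> c ` {0..dist x y}"
proof -
  interpret cat0_geodesic "{0..dist x y}" c
    by standard (use assms in \<open>auto simp: geodesic_joining_def\<close>)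
  show "connected (c ` {0..dist x y})"
    by (rule connected_continuous_image) (use continuous in auto)
  have "c 0 = x" "c (dist x y) = y" using assms by (auto simp: geodesic_joining_def)
  then show "x \<in> c ` {0..dist x y}" "y \<in> c ` {0..dist x y}"
    by (metis atLeastAtMost_iff imageI order_refl zero_le_dist)+
qed

lemma geodesic_joining_dist:
  assumes "geodesic_joining c x y" "z \<in> c ` {0..dist x y}"
  shows "dist x z + dist z y = dist x y"
proof -
  obtain u where u: "u \<in> {0..dist x y}" "z = c u" using assms(2) by auto
  have g: "geodesic_on {0..dist x y} c" "c 0 = x" "c (dist x y) = y"
    using assms(1) by (auto simp: geodesic_joining_def)
  show ?thesis
    using geodesic_onD[OF g(1), of 0 u] geodesic_onD[OF g(1) u(1), of "dist x y"] g(2,3) u by simp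
qed

text \<open>A curtain has width 1 and the foot map is 1-Lipschitz. The point \<open>w\<close> is
  taken on the geodesic from \<open>x\<close> to \<open>y\<close>, on the boundary of
  \<open>h\<close> facing \<open>A\<close>; from there to \<open>y\<close> the distance is still at
  least 1.\<close>

lemma sides_thick:
  fixes h :: "'a::cat0_space set"
  assumes "sides h A B" "x \<in> A" "y \<in> B"
  obtains w where "w \<in> h" "dist x w + 1 \<le> dist x y"
proof -
  obtain I a r where *: "cat0_geodesic I a" "{r - 1/2..r + 1/2} \<subseteq> I"
    "h = {x. r - 1/2 \<le> foot I a x \<and> foot I a x \<le> r + 1/2}"
    "A = {x. foot I a x < r - 1/2} \<and> B = {x. r + 1/2 < foot I a x} \<or>
     A = {x. r + 1/2 < foot I a x} \<and> B = {x. foot I a x < r - 1/2}"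
    using sides_cases[OF assms(1)] .
  interpret cat0_geodesic I a by fact
  obtain c where c: "geodesic_joining c x y" using ex_geodesic by blast
  note Z = connected_geodesic_image[OF c]
  have "\<exists>w \<in> c ` {0..dist x y}. w \<in> h \<and> 1 \<le> dist w y"
    using *(4)
  proof
    assume AB: "A = {x. foot I a x < r - 1/2} \<and> B = {x. r + 1/2 < foot I a x}"
    obtain w where w: "w \<in> c ` {0..dist x y}" "foot I a w = r - 1/2"
      using connected_meets_fibre[OF Z, of "r - 1/2"] assms AB by auto
    then show ?thesis using assms AB *(3) foot_lipschitz[of w y] by (intro bexI[of _ w]) auto
  next
    assume AB: "A = {x. r + 1/2 < foot I a x} \<and> B = {x. foot I a x < r - 1/2}"
    obtain w where w: "w \<in> c ` {0..dist x y}" "foot I a w = r + 1/2"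
      using connected_meets_fibre[OF Z(1,3,2), of "r + 1/2"] assms AB by auto
    then show ?thesis using assms AB *(3) foot_lipschitz[of w y] by (intro bexI[of _ w]) auto
  qed
  then obtain w where w: "w \<in> c ` {0..dist x y}" "w \<in> h" "1 \<le> dist w y" by blast
  then show thesis using that[of w] geodesic_joining_dist[OF c w(1)] by linarith
qed

section \<open>The linear order of a chain\<close>

locale curtain_chain_sides =
  fixes J :: "int set" and g A B :: "int \<Rightarrow> 'a::cat0_space set"
  assumes chain: "curtain_chain J g"
    and sides_at: "\<lbrakk>i - 1 \<in> J; i \<in> J; i + 1 \<in> J\<rbrakk> \<Longrightarrow> sides (g i) (A i) (B i)"
    and before: "\<lbrakk>i - 1 \<in> J; i \<in> J; i + 1 \<in> J\<rbrakk> \<Longrightarrow> g (i - 1) \<subseteq> A i"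
    and after: "\<lbrakk>i - 1 \<in> J; i \<in> J; i + 1 \<in> J\<rbrakk> \<Longrightarrow> g (i + 1) \<subseteq> B i"
begin

lemma index_between: "j \<in> J \<Longrightarrow> m \<in> J \<Longrightarrow> j \<le> i \<Longrightarrow> i \<le> m \<Longrightarrow> i \<in> J"
  using chain unfolding curtain_chain_def by (metis atLeastAtMost_iff subsetD)

lemma chain_curtain:
  assumes "i \<in> J" shows "connected (g i)" "g i \<noteq> {}"
proof -
  obtain X Y where "sides (g i) X Y"
    using ex_sides chain assms unfolding curtain_chain_def by blast
  then show "connected (g i)" "g i \<noteq> {}" by (auto dest: sides_connected sides_nonempty)
qed

lemma chain_disjoint: "i \<in> J \<Longrightarrow> j \<in> J \<Longrightarrow> i \<noteq> j \<Longrightarrow> g i \<inter> g j = {}"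
  using chain unfolding curtain_chain_def disjoint_family_on_def by blast

text \<open>Induction on the gap \<open>m - j\<close>. If \<open>g m\<close> lay in
  \<open>A j\<close>, the connected set \<open>A j \<union> g j\<close> would contain both
  \<open>g j\<close>, which is before \<open>g (m - 1)\<close>, and \<open>g m\<close>, which is
  after it. It would then meet \<open>g (m - 1)\<close>, although that curtain lies in
  \<open>B j\<close> by induction. The other half is symmetric, with
  \<open>g (j + 1)\<close>.\<close>

lemma order_aux:
  assumes "j \<in> J" "m \<in> J" "j < m" "m - j \<le> int n"
  shows "(m + 1 \<in> J \<longrightarrow> g j \<subseteq> A m) \<and> (j - 1 \<in> J \<longrightarrow> g m \<subseteq> B j)"
  using assms
proof (induction n arbitrary: j m)
  case (Suc n)
  show ?case
  proof (cases "m = j + 1")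
    case True
    then show ?thesis using before[of m] after[of j] Suc.prems by auto
  next
    case False
    then have jm: "j + 1 < m" using Suc.prems by simp
    have J: "j + 1 \<in> J" "m - 1 \<in> J" "m - 1 - 1 \<in> J" "j + 1 + 1 \<in> J"
      using index_between[OF Suc.prems(1,2)] jm by auto
    have 1: "g m \<subseteq> B j" if "j - 1 \<in> J"
    proof (rule ccontr)
      assume "\<not> g m \<subseteq> B j"
      have s: "sides (g j) (A j) (B j)" using sides_at that J Suc.prems by simp
      have "g m \<subseteq> A j"
        using sides_connected_cases[OF s chain_curtain(1)[OF Suc.prems(2)]]
          chain_disjoint[of m j] Suc.prems \<open>\<not> g m \<subseteq> B j\<close> by auto
      have s': "sides (g (m - 1)) (A (m - 1)) (B (m - 1))"
        using sides_at[of "m - 1"] J Suc.prems by simp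
      have "g (m - 1) \<subseteq> B j" "g j \<subseteq> A (m - 1)"
        using Suc.IH[of j "m - 1"] J that jm Suc.prems by auto
      moreover have "g m \<subseteq> B (m - 1)" using after[of "m - 1"] J Suc.prems by simp
      ultimately have "(A j \<union> g j) \<inter> g (m - 1) \<noteq> {}"
        using chain_curtain[OF Suc.prems(1)] chain_curtain[OF Suc.prems(2)] \<open>g m \<subseteq> A j\<close>
        by (intro sides_cross[OF s' sides_connected_Un[OF s]]) auto
      then show False
        using \<open>g (m - 1) \<subseteq> B j\<close> sides_disjoint[OF s] by auto
    qed
    have 2: "g j \<subseteq> A m" if "m + 1 \<in> J"
    proof (rule ccontr)
      assume "\<not> g j \<subseteq> A m"
      have s: "sides (g m) (A m) (B m)" using sides_at that J Suc.prems by simp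
      have "g j \<subseteq> B m"
        using sides_connected_cases[OF s chain_curtain(1)[OF Suc.prems(1)]]
          chain_disjoint[of m j] Suc.prems \<open>\<not> g j \<subseteq> A m\<close> by auto
      have s': "sides (g (j + 1)) (A (j + 1)) (B (j + 1))"
        using sides_at[of "j + 1"] J Suc.prems by simp
      have "g (j + 1) \<subseteq> A m" "g m \<subseteq> B (j + 1)"
        using Suc.IH[of "j + 1" m] J that jm Suc.prems by auto
      moreover have "g j \<subseteq> A (j + 1)" using before[of "j + 1"] J Suc.prems by simp
      ultimately have "(B m \<union> g m) \<inter> g (j + 1) \<noteq> {}"
        using chain_curtain[OF Suc.prems(1)] chain_curtain[OF Suc.prems(2)] \<open>g j \<subseteq> B m\<close>
        by (intro sides_cross[OF s' sides_connected_Un[OF sides_commute[OF s]]]) auto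
      then show False
        using \<open>g (j + 1) \<subseteq> A m\<close> sides_disjoint[OF s] by auto
    qed
    from 1 2 show ?thesis by blast
  qed
qed simp

lemma before_all: "j \<in> J \<Longrightarrow> m \<in> J \<Longrightarrow> m + 1 \<in> J \<Longrightarrow> j < m \<Longrightarrow> g j \<subseteq> A m"
  using order_aux[of j m "nat (m - j)"] by simp

lemma after_all: "j \<in> J \<Longrightarrow> m \<in> J \<Longrightarrow> j - 1 \<in> J \<Longrightarrow> j < m \<Longrightarrow> g m \<subseteq> B j"
  using order_aux[of j m "nat (m - j)"] by simp

text \<open>Each of the \<open>k - j - 1\<close> curtains strictly in between costs distance 1 by
  \<open>sides_thick\<close>; neighbouring curtains themselves may be arbitrarily close.\<close>

lemma chain_dist:
  assumes "j \<in> J" "k \<in> J" "j < k" "x \<in> g j" "y \<in> g k"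
  shows "real_of_int (k - j) - 1 \<le> dist x y"
proof -
  have "k = j + 1 + int n \<Longrightarrow> k \<in> J \<Longrightarrow> y \<in> g k \<Longrightarrow> real n \<le> dist x y" for n k y
  proof (induction n arbitrary: k y)
    case (Suc n)
    define m where "m = k - 1"
    have m: "m - 1 \<in> J" "m \<in> J" "m + 1 \<in> J" "j < m" "k = m + 1"
      using index_between[OF assms(1) Suc.prems(2)] Suc.prems by (auto simp: m_def)
    have "x \<in> A m" using before_all[OF assms(1) m(2,3,4)] assms(4) by blast
    moreover have "y \<in> B m" using after[OF m(1-3)] Suc.prems(3) m(5) by blast
    ultimately obtain w where w: "w \<in> g m" "dist x w + 1 \<le> dist x y"
      using sides_thick[OF sides_at[OF m(1-3)]] by blast
    have "real n \<le> dist x w" using Suc.IH[of m w] Suc.prems m w by simp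
    then show ?case using w(2) by simp
  qed simp
  from this[of k "nat (k - j - 1)" y] show ?thesis using assms by simp
qed

end

lemma curtain_chain_sidesE:
  fixes g :: "int \<Rightarrow> 'a::cat0_space set"
  assumes "curtain_chain J g"
  obtains A B where "curtain_chain_sides J g A B"
proof -
  have "\<forall>i. \<exists>A B. i - 1 \<in> J \<and> i \<in> J \<and> i + 1 \<in> J \<longrightarrow>
      sides (g i) A B \<and> g (i - 1) \<subseteq> A \<and> g (i + 1) \<subseteq> B"
    using assms unfolding curtain_chain_def separates_iff_sides by blast
  then obtain A B where "\<forall>i. i - 1 \<in> J \<and> i \<in> J \<and> i + 1 \<in> J \<longrightarrow>
      sides (g i) (A i) (B i) \<and> g (i - 1) \<subseteq> A i \<and> g (i + 1) \<subseteq> B i"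
    by metis
  then have "curtain_chain_sides J g A B"
    using assms by (auto simp: curtain_chain_sides_def)
  then show thesis by (rule that)
qed

text \<open>Chains may be infinite, so finiteness comes first, from a window around one element;
  then the least and greatest elements give the sharp count.\<close>

lemma card_int_set_bounded:
  fixes J :: "int set" and D :: real
  assumes "\<And>j k. j \<in> J \<Longrightarrow> k \<in> J \<Longrightarrow> j < k \<Longrightarrow> real_of_int (k - j) \<le> D" and "0 \<le> D"
  shows "finite J \<and> real (card J) \<le> D + 1"
proof (cases "J = {}")
  case False
  then obtain j0 where j0: "j0 \<in> J" by blast
  have "J \<subseteq> {j0 - \<lfloor>D\<rfloor>..j0 + \<lfloor>D\<rfloor>}"
  proof
    fix k assume "k \<in> J"
    then have "real_of_int \<bar>k - j0\<bar> \<le> D"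
      using assms(1)[OF j0, of k] assms(1)[of k j0] j0 assms(2)
      by (cases k j0 rule: linorder_cases) auto
    then have "\<bar>k - j0\<bar> \<le> \<lfloor>D\<rfloor>" by (simp add: le_floor_iff)
    then show "k \<in> {j0 - \<lfloor>D\<rfloor>..j0 + \<lfloor>D\<rfloor>}" by auto
  qed
  then have fin: "finite J" using finite_subset by blast
  define m M where "m = Min J" and "M = Max J"
  have mM: "m \<in> J" "M \<in> J" "J \<subseteq> {m..M}" using fin False by (auto simp: m_def M_def)
  have "real_of_int (M - m) \<le> D"
    using assms(1)[OF mM(1,2)] assms(2) mM by (cases m M rule: linorder_cases) auto
  moreover have "card J \<le> card {m..M}" by (rule card_mono) (use mM in auto)
  moreover have "m \<le> M" using mM by auto
  ultimately show ?thesis using fin by simp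
qed (use assms in simp)

section \<open>Chains dual to one geodesic\<close>

context cat0_geodesic
begin

lemma dual_curtain_chain:
  assumes J: "\<And>i k. i \<in> J \<Longrightarrow> k \<in> J \<Longrightarrow> {i..k} \<subseteq> J"
    and I: "\<And>m. m \<in> J \<Longrightarrow> {q m - 1/2..q m + 1/2} \<subseteq> interior I"
    and q: "\<And>m m'. m \<in> J \<Longrightarrow> m' \<in> J \<Longrightarrow> m < m' \<Longrightarrow> q m + 1 < q m'"
  shows "curtain_chain J (\<lambda>m. dual_curtain I a (q m))"
proof -
  have data: "curtain_data I a (q m)" if "m \<in> J" for m
    using I[of m] that geodesic by (simp add: curtain_data_def)
  have eq: "dual_curtain I a (q m) =
      {x. q m - 1/2 \<le> foot I a x \<and> foot I a x \<le> q m + 1/2}" if "m \<in> J" for m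
    using dual_curtain_eq curtain_dataD(2)[OF data[OF that]] by blast
  have "disjoint_family_on (\<lambda>m. dual_curtain I a (q m)) J"
    unfolding disjoint_family_on_def
  proof (intro ballI impI)
    fix m m' assume m: "m \<in> J" "m' \<in> J" "m \<noteq> m'"
    then have "q m + 1 < q m' \<or> q m' + 1 < q m"
      using q[of m m'] q[of m' m] by (cases m m' rule: linorder_cases) auto
    then show "dual_curtain I a (q m) \<inter> dual_curtain I a (q m') = {}"
      unfolding eq[OF m(1)] eq[OF m(2)] by auto
  qed
  moreover have "separates (dual_curtain I a (q i)) (dual_curtain I a (q (i - 1)))
      (dual_curtain I a (q (i + 1)))"
    if "i - 1 \<in> J" "i \<in> J" "i + 1 \<in> J" for i
  proof -
    have "q (i - 1) + 1 < q i" "q i + 1 < q (i + 1)" using q[of "i - 1" i] q[of i "i + 1"] that by auto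
    then have "dual_curtain I a (q (i - 1)) \<subseteq> half_minus I a (q i)"
      "dual_curtain I a (q (i + 1)) \<subseteq> half_plus I a (q i)"
      unfolding eq[OF that(1)] eq[OF that(3)] half_minus_eq half_plus_eq by auto
    then show ?thesis unfolding separates_def using data[OF that(2)]
      by (intro exI[of _ I] exI[of _ a] exI[of _ "q i"] conjI disjI1 refl)
  qed
  moreover have "\<forall>i\<in>J. is_curtain (dual_curtain I a (q i))"
    unfolding is_curtain_def by (intro ballI exI conjI, rule data) auto
  moreover have "\<forall>i\<in>J. \<forall>k\<in>J. {i..k} \<subseteq> J" using J by blast
  ultimately show ?thesis unfolding curtain_chain_def by (intro conjI allI impI) auto
qed

text \<open>How separation is exploited: a curtain is connected, so if it has points with feet on
  both sides of \<open>{p..q}\<close>, it meets every curtain dual to \<open>a\<close> in between.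
  Two separated curtains of this kind allow only few such curtains, hence a short interval.\<close>

lemma L_separated_length_bound:
  assumes sep: "L_separated L h h'"
    and h: "x \<in> h" "y \<in> h" "foot I a x \<le> p" "q \<le> foot I a y"
    and h': "x' \<in> h'" "y' \<in> h'" "foot I a x' \<le> p" "q \<le> foot I a y'"
    and pq: "{p..q} \<subseteq> I"
  shows "q - p \<le> 2 * L + 4"
proof -
  \<comment> \<open>Centres \<open>p + 2\<close>, \<open>p + 4\<close>, and so on keep the unit
    curtains disjoint; subtracting 2 keeps the last one inside \<open>{p..q}\<close>. If
    \<open>n\<close> is not positive, the chain is empty.\<close>
  define n where "n = \<lceil>(q - p) / 2\<rceil> - 2"
  let ?r = "\<lambda>m::int. p + 2 * real_of_int m"
  let ?g = "\<lambda>m. dual_curtain I a (?r m)"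
  have r: "p < ?r m - 1/2" "?r m + 1/2 < q" if "1 \<le> m" "m \<le> n" for m
  proof -
    have "m + 2 \<le> \<lceil>(q - p) / 2\<rceil>" using that by (simp add: n_def)
    then have "real_of_int (m + 1) < (q - p) / 2" by linarith
    then show "p < ?r m - 1/2" "?r m + 1/2 < q" using that by (auto simp: field_simps)
  qed
  have "{p<..<q} \<subseteq> interior I"
    by (rule interior_maximal) (use pq in auto)
  then have rI: "{?r m - 1/2..?r m + 1/2} \<subseteq> interior I" if "1 \<le> m" "m \<le> n" for m
  proof -
    have "{?r m - 1/2..?r m + 1/2} \<subseteq> {p<..<q}" using r[OF that] by auto
    then show ?thesis using \<open>{p<..<q} \<subseteq> interior I\<close> by (rule subset_trans)
  qed
  have chain: "curtain_chain {1..n} ?g"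
    proof (rule dual_curtain_chain)
    show "{?r m - 1/2..?r m + 1/2} \<subseteq> interior I" if "m \<in> {1..n}" for m
      by (rule rI) (use that in auto)
  qed auto
  obtain X Y where "curtain_chain_sides {1..n} ?g X Y" using curtain_chain_sidesE[OF chain] .
  then interpret C: curtain_chain_sides "{1..n}" ?g X Y .
  \<comment> \<open>\<open>L_separated\<close> counts curtains as sets, not their indices.\<close>
  have "inj_on ?g {1..n}"
  proof (rule inj_onI, rule ccontr)
    fix i j assume "i \<in> {1..n}" "j \<in> {1..n}" "?g i = ?g j" "i \<noteq> j"
    then show False using C.chain_disjoint[of i j] C.chain_curtain(2)[of i] by auto
  qed
  then have card: "card (?g ` {1..n}) = nat n" by (simp add: card_image)
  have meets: "chain_meets {1..n} ?g k"
    if k: "is_curtain k" "x \<in> k" "y \<in> k" "foot I a x \<le> p" "q \<le> foot I a y" for k x y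
    unfolding chain_meets_def
  proof
    fix m assume m: "m \<in> {1..n}"
    have "connected k" using ex_sides[OF k(1)] sides_connected by blast
    then obtain z where z: "z \<in> k" "foot I a z = ?r m"
      using connected_meets_fibre[of k x y "?r m"] r[of m] k m by auto
    have "{?r m - 1/2..?r m + 1/2} \<subseteq> I"
      using m interior_subset by (intro subset_trans[OF rI[of m]]) auto
    then have "z \<in> ?g m" using \<open>foot I a z = ?r m\<close> by (simp add: dual_curtain_eq)
    then show "?g m \<inter> k \<noteq> {}" using \<open>z \<in> k\<close> by blast
  qed
  have "is_curtain h" "is_curtain h'" using sep by (auto simp: L_separated_def)
  then have "chain_meets {1..n} ?g h" "chain_meets {1..n} ?g h'"
    using meets h h' by blast+
  then have "real (card (?g ` {1..n})) \<le> L" using sep chain unfolding L_separated_def by blast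
  then have "real (nat n) \<le> L" by (simp add: card)
  then have "real_of_int n \<le> L" by (rule order_trans[rotated]) simp
  moreover have "(q - p) / 2 - 2 \<le> real_of_int n" unfolding n_def by linarith
  ultimately have "(q - p) / 2 - 2 \<le> L" by (rule order_trans[rotated])
  then show ?thesis by (simp add: field_simps)
qed

end

section \<open>Sublinear functions\<close>

locale sublinear =
  fixes \<kappa> :: "real \<Rightarrow> real"
  assumes sublinear: "sublinear_fun \<kappa>"
begin

lemma kappa_ge_1: "0 \<le> t \<Longrightarrow> 1 \<le> \<kappa> t"
  using sublinear by (simp add: sublinear_fun_def)

lemma kappa_mono: "0 \<le> s \<Longrightarrow> s \<le> t \<Longrightarrow> \<kappa> s \<le> \<kappa> t"
  using sublinear by (auto simp: sublinear_fun_def mono_on_def)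

text \<open>Concavity at the midpoint of 0 and \<open>2 * t\<close>, where \<open>\<kappa> 0\<close>
  is positive. It permits changing an argument by a factor 2 at the cost of a factor 2.\<close>

lemma kappa_double: assumes "0 \<le> t" shows "\<kappa> (2 * t) \<le> 2 * \<kappa> t"
proof -
  have c: "concave_on {0..} \<kappa>" using sublinear by (simp add: sublinear_fun_def)
  have "(1 - 1/2) * \<kappa> 0 + 1/2 * \<kappa> (2 * t) \<le> \<kappa> ((1 - 1/2) *\<^sub>R 0 + (1/2) *\<^sub>R (2 * t))"
    by (rule concave_onD[OF c]) (use assms in auto)
  then show ?thesis using kappa_ge_1[of 0] by simp
qed

lemma kappa_le_double: "0 \<le> t \<Longrightarrow> 0 \<le> s \<Longrightarrow> s \<le> 2 * t \<Longrightarrow> \<kappa> s \<le> 2 * \<kappa> t"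
  using kappa_mono[of s "2 * t"] kappa_double[of t] by linarith

lemma kappa_eventually_le:
  assumes "0 < c"
  obtains T where "0 < T" "\<And>t. T \<le> t \<Longrightarrow> c * \<kappa> t \<le> t"
proof -
  have lim: "((\<lambda>t. \<kappa> t / t) \<longlongrightarrow> 0) at_top" using sublinear by (simp add: sublinear_fun_def)
  have "\<forall>\<^sub>F t in at_top. \<kappa> t / t < 1 / c"
    by (rule order_tendstoD(2)[OF lim]) (use assms in simp)
  then obtain N where N: "\<And>t. N \<le> t \<Longrightarrow> \<kappa> t / t < 1 / c"
    unfolding eventually_at_top_linorder by blast
  have "c * \<kappa> t \<le> t" if "max 1 N \<le> t" for t
    using N[of t] that assms by (simp add: field_simps)
  then show thesis using that[of "max 1 N"] by simp
qed

end

section \<open>Geodesics inside curtains\<close>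

lemma geodesic_joining_reverse:
  assumes "geodesic_joining c x y"
  shows "geodesic_joining (\<lambda>u. c (dist x y - u)) y x"
    "(\<lambda>u. c (dist x y - u)) ` {0..dist y x} = c ` {0..dist x y}"
proof -
  show "geodesic_joining (\<lambda>u. c (dist x y - u)) y x"
    using assms unfolding geodesic_joining_def geodesic_on_def by (auto simp: dist_commute)
  have "(\<lambda>u. dist x y - u) ` {0..dist x y} = {0..dist x y}"
    by (simp add: image_diff_atLeastAtMost)
  moreover have "(\<lambda>u. c (dist x y - u)) ` {0..dist y x} = c ` (\<lambda>u. dist x y - u) ` {0..dist x y}"
    by (simp only: image_image dist_commute[of y x])
  ultimately show "(\<lambda>u. c (dist x y - u)) ` {0..dist y x} = c ` {0..dist x y}"
    by (simp only:)
qed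

definition joined_in :: "'a::metric_space set \<Rightarrow> 'a \<Rightarrow> 'a \<Rightarrow> bool" where
  "joined_in S x y \<longleftrightarrow> (\<exists>c. geodesic_joining c x y \<and> c ` {0..dist x y} \<subseteq> S)"

lemma joined_in_commute: "joined_in S x y \<Longrightarrow> joined_in S y x"
  unfolding joined_in_def using geodesic_joining_reverse by metis

context cat0_geodesic
begin

lemma joined_in_segment:
  assumes "s \<in> I" "t \<in> I" "a ` ({min s t..max s t}) \<subseteq> S"
  shows "joined_in S (a s) (a t)"
proof -
  have *: "joined_in S (a s) (a t)"
    if st: "s \<in> I" "t \<in> I" "s \<le> t" "a ` {s..t} \<subseteq> S" for s t
  proof -
    have d: "dist (a s) (a t) = t - s" using dist_geodesic st by simp
    have "geodesic_joining (\<lambda>u. a (s + u)) (a s) (a t)"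
      using geodesic_joining_shift[OF geodesic st(1-3)] .
    moreover have "(\<lambda>u. a (s + u)) ` {0..dist (a s) (a t)} \<subseteq> S"
      using st by (auto simp: d)
    ultimately show ?thesis unfolding joined_in_def by blast
  qed
  show ?thesis
  proof (cases "s \<le> t")
    case True
    then show ?thesis using *[of s t] assms by simp
  next
    case False
    then show ?thesis using *[of t s] assms joined_in_commute by simp
  qed
qed

end

text \<open>A curtain need not be convex, but one can go down a perpendicular, along the dual
  geodesic, and up another perpendicular.\<close>

lemma curtain_three_geodesics:
  fixes g :: "'a::cat0_space set"
  assumes "is_curtain g" "x \<in> g" "y \<in> g"
  obtains p q where "joined_in g x p" "joined_in g p q" "joined_in g q y"
proof -
  obtain I a r where data: "curtain_data I a r" and "g = dual_curtain I a r"
    using assms(1) by (auto simp: is_curtain_def)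
  interpret cat0_geodesic I a using curtain_dataD[OF data] by simp
  have rI: "{r - 1/2..r + 1/2} \<subseteq> I" using curtain_dataD[OF data] by simp
  have g: "g = {x. r - 1/2 \<le> foot I a x \<and> foot I a x \<le> r + 1/2}"
    using dual_curtain_eq[OF rI] \<open>g = _\<close> by simp
  have 1: "joined_in g (a (foot I a z)) z" if "z \<in> g" for z
  proof -
    obtain c where c: "geodesic_joining c (a (foot I a z)) z" using ex_geodesic by blast
    have "c ` {0..dist (a (foot I a z)) z} \<subseteq> g"
      using foot_on_perpendicular(1)[OF c] that by (auto simp: g dist_commute)
    then show ?thesis using c unfolding joined_in_def by blast
  qed
  have "a ` {min (foot I a x) (foot I a y)..max (foot I a x) (foot I a y)} \<subseteq> g"
    using assms(2,3) rI by (auto simp: g foot_self subset_iff min_le_iff_disj le_max_iff_disj)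
  then have "joined_in g (a (foot I a x)) (a (foot I a y))"
    by (intro joined_in_segment foot_in)
  then show thesis using that 1 assms(2,3) joined_in_commute by metis
qed

section \<open>Contracting geodesics\<close>

text \<open>For points \<open>x'\<close> and \<open>y'\<close> at height \<open>\<rho>\<close> and
  \<open>y\<close> above \<open>y'\<close> at height \<open>R\<close>: \<open>D\<close> is the
  distance from \<open>x'\<close> to \<open>y'\<close>, \<open>A\<close> that from \<open>x'\<close>
  to the foot of \<open>y\<close>, and \<open>X\<close> that from \<open>x'\<close> to
  \<open>y\<close>. The hypothesis \<open>st\<close> is Stewart's inequality at
  \<open>y'\<close>.\<close>

lemma first_slide_real:
  fixes R A D X \<rho> \<Delta> :: real
  assumes "0 < \<rho>" "\<rho> \<le> R" "\<rho> \<le> A" "A \<le> \<rho> + \<Delta>" "2 * \<Delta> \<le> \<rho>" "2 * \<rho> \<le> D" "0 \<le> X"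
    and st: "R * D\<^sup>2 \<le> (R - \<rho>) * A\<^sup>2 + \<rho> * X\<^sup>2 - R * \<rho> * (R - \<rho>)"
  shows "R + \<rho> - 2 * \<Delta> \<le> X"
proof -
  have \<Delta>: "0 \<le> \<Delta>" using assms by linarith
  have "(2 * \<rho>)\<^sup>2 \<le> D\<^sup>2" by (rule power_mono) (use assms in auto)
  then have "R * (4 * \<rho>\<^sup>2) \<le> R * D\<^sup>2"
    using assms by (intro mult_left_mono) (auto simp: power2_eq_square)
  moreover have "A\<^sup>2 \<le> (\<rho> + \<Delta>)\<^sup>2" by (rule power_mono) (use assms in auto)
  then have "A\<^sup>2 \<le> \<rho>\<^sup>2 + 4 * \<rho> * \<Delta>"
    using mult_right_mono[OF assms(5) \<Delta>] mult_nonneg_nonneg[OF \<Delta>, of \<rho>] assms(1)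
    by (simp add: power2_eq_square algebra_simps)
  then have "R * A\<^sup>2 \<le> R * (\<rho>\<^sup>2 + 4 * \<rho> * \<Delta>)" using assms by (intro mult_left_mono) auto
  \<comment> \<open>A deliberately weak lower bound: it completes the square
    \<open>(R + \<rho> - 2 * \<Delta>)\<^sup>2\<close>.\<close>
  moreover have "(\<rho> - 2 * \<Delta>)\<^sup>2 \<le> A\<^sup>2" by (rule power_mono) (use assms \<Delta> in auto)
  then have "\<rho> * (\<rho> - 2 * \<Delta>)\<^sup>2 \<le> \<rho> * A\<^sup>2" using assms by (intro mult_left_mono) auto
  ultimately have "\<rho> * (R + \<rho> - 2 * \<Delta>)\<^sup>2 \<le> \<rho> * X\<^sup>2"
    using st by (simp add: power2_eq_square algebra_simps)
  then have "(R + \<rho> - 2 * \<Delta>)\<^sup>2 \<le> X\<^sup>2" using assms(1) by simp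
  then show ?thesis using assms(7) by (rule power2_le_imp_le)
qed

text \<open>The next slide, of \<open>x'\<close> up to \<open>x\<close> at height \<open>R\<close>
  while \<open>y\<close> stays fixed: \<open>A\<close>, \<open>D\<close> and \<open>X\<close> are
  the distances from \<open>y\<close> to the foot of \<open>x\<close>, to \<open>x'\<close> and to
  \<open>x\<close>.\<close>

lemma second_slide_real:
  fixes R A D X \<rho> \<Delta> :: real
  assumes "\<rho> = 24 * \<Delta>" "0 < \<rho>" "\<rho> \<le> R" "R \<le> A" "A + \<rho> - 3 * \<Delta> \<le> D" "0 \<le> X"
    and st: "R * D\<^sup>2 \<le> (R - \<rho>) * A\<^sup>2 + \<rho> * X\<^sup>2 - R * \<rho> * (R - \<rho>)"
  shows "A + R / 2 \<le> X"
proof -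
  have "(A + \<rho> - 3 * \<Delta>)\<^sup>2 \<le> D\<^sup>2" by (rule power_mono) (use assms in auto)
  moreover have "(A + \<rho> - 3 * \<Delta>)\<^sup>2 = A\<^sup>2 + 42 * (A * \<Delta>) + 441 * \<Delta>\<^sup>2"
    "\<rho>\<^sup>2 = 576 * \<Delta>\<^sup>2" "3/2 * A * \<rho> = 36 * (A * \<Delta>)"
    using assms(1) by (auto simp: power2_eq_square algebra_simps)
  \<comment> \<open>This is where 24 is large enough: the surplus \<open>6 * (A * \<Delta>)\<close>
    is at least \<open>144 * \<Delta>\<^sup>2\<close> and covers the deficit
    \<open>(576 - 441) * \<Delta>\<^sup>2\<close>.\<close>
  moreover have "\<rho> * \<Delta> \<le> A * \<Delta>" using assms by (intro mult_right_mono) auto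
  then have "24 * \<Delta>\<^sup>2 \<le> A * \<Delta>" using assms(1) by (simp add: power2_eq_square)
  ultimately have "A\<^sup>2 + \<rho>\<^sup>2 + 3/2 * A * \<rho> \<le> D\<^sup>2"
    using zero_le_power2[of \<Delta>] by linarith
  then have "R * (A\<^sup>2 + \<rho>\<^sup>2 + 3/2 * A * \<rho>) \<le> R * D\<^sup>2" using assms by (intro mult_left_mono) auto
  then have "\<rho> * (A\<^sup>2 + 3/2 * A * R + R\<^sup>2) \<le> \<rho> * X\<^sup>2"
    using st by (simp add: power2_eq_square algebra_simps)
  then have "A\<^sup>2 + 3/2 * A * R + R\<^sup>2 \<le> X\<^sup>2" using assms(2) by simp
  moreover have "(A + R / 2)\<^sup>2 = A\<^sup>2 + A * R + R\<^sup>2 / 4" "3/2 * A * R = 3/2 * (A * R)"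
    by (auto simp: power2_eq_square algebra_simps)
  moreover have "0 \<le> A * R" using assms by simp
  ultimately have "(A + R / 2)\<^sup>2 \<le> X\<^sup>2" using zero_le_power2[of R] by linarith
  then show ?thesis using assms(6) by (rule power2_le_imp_le)
qed

context cat0_geodesic
begin

abbreviation height :: "'a \<Rightarrow> real" where
  "height x \<equiv> dist x (a (foot I a x))"

lemma dist_le_via_geodesic:
  "dist x y \<le> height x + \<bar>foot I a x - foot I a y\<bar> + height y"
  using dist_triangle[of x y "a (foot I a x)"]
    dist_triangle[of "a (foot I a x)" y "a (foot I a y)"] dist_geodesic[OF foot_in[of x] foot_in[of y]]
  by (simp add: dist_commute)

text \<open>
  Sliding down the two perpendiculars, the convexity of \<open>u \<mapsto> (dist z (c u))\<^sup>2 - u\<^sup>2\<close> along a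
  geodesic \<open>c\<close> propagates the lower bound at height \<open>\<rho>\<close> to all larger heights. Plain convexity
  of the distance would be too weak.
\<close>

lemma perpendiculars_diverge_aux:
  assumes base: "\<And>x' y'. \<lbrakk>foot I a x' = foot I a x; foot I a y' = foot I a y;
      height x' = \<rho>; height y' = \<rho>\<rbrakk> \<Longrightarrow> 2 * \<rho> \<le> dist x' y'"
    and \<Delta>: "\<bar>foot I a x - foot I a y\<bar> = \<Delta>" "\<rho> = 24 * \<Delta>" "0 < \<Delta>"
    and h: "\<rho> \<le> height x" "height x \<le> height y"
  shows "height x / 2 + height y \<le> dist x y"
proof -
  let ?p = "a (foot I a x)" and ?q = "a (foot I a y)"
  obtain c where c: "geodesic_joining c ?p x" using ex_geodesic by blast
  obtain e where e: "geodesic_joining e ?q y" using ex_geodesic by blast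
  have \<rho>: "0 < \<rho>" "\<rho> \<le> height y" using \<Delta> h by auto
  have pq: "dist ?p ?q = \<Delta>" using dist_geodesic[OF foot_in foot_in] \<Delta> by simp
  define x' y' where "x' = c \<rho>" and "y' = e \<rho>"
  have x': "foot I a x' = foot I a x" "dist x' ?p = \<rho>"
    using foot_on_perpendicular[OF c, of \<rho>] \<rho> h by (auto simp: x'_def)
  have y': "foot I a y' = foot I a y" "dist y' ?q = \<rho>"
    using foot_on_perpendicular[OF e, of \<rho>] \<rho> h by (auto simp: y'_def)
  have "2 * \<rho> \<le> dist x' y'" using base x' y' by simp
  \<comment> \<open>Raise only the second point, from \<open>y'\<close> to \<open>y\<close>, against
    the fixed \<open>x'\<close>.\<close>
  have "height y + \<rho> - 2 * \<Delta> \<le> dist x' y"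
  proof (rule first_slide_real)
    show "\<rho> \<le> dist x' ?q" using foot_le[OF foot_in, of x' y] x' by simp
    show "dist x' ?q \<le> \<rho> + \<Delta>" using dist_triangle[of x' ?q ?p] x' pq by simp
    show "height y * (dist x' y')\<^sup>2 \<le>
        (height y - \<rho>) * (dist x' ?q)\<^sup>2 + \<rho> * (dist x' y)\<^sup>2 - height y * \<rho> * (height y - \<rho>)"
      using geodesic_joining_stewart[OF e, of \<rho> x'] \<rho> by (simp add: y'_def dist_commute)
  qed (use \<rho> \<Delta> \<open>2 * \<rho> \<le> dist x' y'\<close> in auto)
  have A: "height y \<le> dist y ?p" "dist y ?p \<le> height y + \<Delta>"
    using foot_le[OF foot_in, of y x] dist_triangle[of y ?p ?q] pq by (auto simp: dist_commute)
  \<comment> \<open>Now raise the lower of the two original points, from \<open>x'\<close> to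
    \<open>x\<close>, against the fixed \<open>y\<close>.\<close>
  have "dist y ?p + height x / 2 \<le> dist y x"
  proof (rule second_slide_real)
    show "height x \<le> dist y ?p" using A h by simp
    show "dist y ?p + \<rho> - 3 * \<Delta> \<le> dist y x'"
      using A \<open>height y + \<rho> - 2 * \<Delta> \<le> dist x' y\<close> by (simp add: dist_commute)
    show "height x * (dist y x')\<^sup>2 \<le>
        (height x - \<rho>) * (dist y ?p)\<^sup>2 + \<rho> * (dist y x)\<^sup>2 - height x * \<rho> * (height x - \<rho>)"
      using geodesic_joining_stewart[OF c, of \<rho> y] \<rho> h by (simp add: x'_def dist_commute)
  qed (use \<rho> \<Delta> h in auto)
  then show ?thesis using A by (simp add: dist_commute)
qed

text \<open>The term \<open>2 * \<rho>\<close> absorbs the case of a point below height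
  \<open>\<rho>\<close>, where the triangle inequality through its foot suffices. Otherwise the two
  points may be ordered by height.\<close>

lemma perpendiculars_diverge:
  assumes base: "\<And>x' y'. \<lbrakk>foot I a x' = foot I a x; foot I a y' = foot I a y;
      height x' = \<rho>; height y' = \<rho>\<rbrakk> \<Longrightarrow> 2 * \<rho> \<le> dist x' y'"
    and \<Delta>: "\<bar>foot I a x - foot I a y\<bar> = \<Delta>" "\<rho> = 24 * \<Delta>" "0 < \<Delta>"
  shows "height x + height y - min (height x) (height y) / 2 - 2 * \<rho> \<le> dist x y"
proof -
  consider "height x < \<rho>" | "height y < \<rho>" | "\<rho> \<le> height x" "height x \<le> height y"
    | "\<rho> \<le> height y" "height y \<le> height x" by linarith
  then show ?thesis
  proof cases
    case 1
    have "height y \<le> dist x y + height x + \<Delta>"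
      using foot_le[OF foot_in, of y x] dist_triangle[of y "a (foot I a x)" x]
      using \<Delta> by (simp add: dist_commute)
    then show ?thesis using 1 \<Delta>(2,3) zero_le_dist[of x y] unfolding min_def
      by (cases "height x \<le> height y"; simp only: if_True if_False; linarith)
  next
    case 2
    have "height x \<le> dist x y + height y + \<Delta>"
      using foot_le[OF foot_in, of x y] dist_triangle[of x "a (foot I a y)" y]
      using \<Delta> by (simp add: dist_commute)
    then show ?thesis using 2 \<Delta>(2,3) zero_le_dist[of x y] unfolding min_def
      by (cases "height x \<le> height y"; simp only: if_True if_False; linarith)
  next
    case 3
    have "height x / 2 + height y \<le> dist x y"
      by (rule perpendiculars_diverge_aux[OF _ \<Delta> 3]) (rule base; assumption)
    then show ?thesis using \<Delta> 3 by (simp add: min_def)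
  next
    case 4
    have base': "2 * \<rho> \<le> dist y' x'"
      if "foot I a y' = foot I a y" "foot I a x' = foot I a x" "height y' = \<rho>" "height x' = \<rho>"
      for x' y'
      using base[OF that(2,1,4,3)] by (simp add: dist_commute)
    have "\<bar>foot I a y - foot I a x\<bar> = \<Delta>" using \<Delta>(1) by (simp add: abs_minus_commute)
    then have "height y / 2 + height x \<le> dist y x"
      by (rule perpendiculars_diverge_aux[OF _ _ \<Delta>(2,3) 4, rotated]) (rule base'; assumption)
    then show ?thesis using \<Delta> 4 by (simp add: min_def dist_commute)
  qed
qed

lemma geodesic_passes_near:
  assumes base: "\<And>x y. \<lbrakk>foot I a x \<in> {p..p + 2 * \<Delta>}; foot I a y \<in> {p..p + 2 * \<Delta>};
      \<bar>foot I a x - foot I a y\<bar> = \<Delta>; height x = 24 * \<Delta>; height y = 24 * \<Delta>\<rbrakk>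
      \<Longrightarrow> 48 * \<Delta> \<le> dist x y"
    and \<Delta>: "0 < \<Delta>"
    and xy: "joined_in S x y" "foot I a x \<le> p" "p + 2 * \<Delta> \<le> foot I a y"
  obtains z where "z \<in> S" "p \<le> foot I a z" "foot I a z \<le> p + 2 * \<Delta>" "height z \<le> 98 * \<Delta>"
proof -
  obtain c where c: "geodesic_joining c x y" "c ` {0..dist x y} \<subseteq> S"
    using xy(1) by (auto simp: joined_in_def)
  interpret c: cat0_geodesic "{0..dist x y}" c
    by standard (use c in \<open>auto simp: geodesic_joining_def\<close>)
  have c0: "c 0 = x" "c (dist x y) = y" using c by (auto simp: geodesic_joining_def)
  let ?f = "\<lambda>u. foot I a (c u)"
  have cont: "continuous_on {u..dist x y} ?f" if "0 \<le> u" for u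
    by (rule continuous_on_compose2[OF continuous_foot[of UNIV]])
      (use that in \<open>auto intro: continuous_on_subset[OF c.continuous]\<close>)
  obtain u1 where u1: "0 \<le> u1" "u1 \<le> dist x y" "?f u1 = p"
    using IVT'[of ?f 0 p "dist x y"] cont[of 0] xy \<Delta> c0 by auto
  obtain u2 where u2: "u1 \<le> u2" "u2 \<le> dist x y" "?f u2 = p + \<Delta>"
    using IVT'[of ?f u1 "p + \<Delta>" "dist x y"] cont[of u1] xy \<Delta> c0 u1 by auto
  obtain u3 where u3: "u2 \<le> u3" "u3 \<le> dist x y" "?f u3 = p + 2 * \<Delta>"
    using IVT'[of ?f u2 "p + 2 * \<Delta>" "dist x y"] cont[of u2] xy \<Delta> c0 u1 u2 by auto
  let ?x = "c u1" and ?z = "c u2" and ?y = "c u3"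
  have "dist ?x ?z = u2 - u1" "dist ?z ?y = u3 - u2" "dist ?x ?y = u3 - u1"
    using c.dist_geodesic u1 u2 u3 by auto
  then have d: "dist ?x ?z + dist ?z ?y = dist ?x ?y" by simp
  have "height ?x + height ?z - min (height ?x) (height ?z) / 2 - 2 * (24 * \<Delta>) \<le> dist ?x ?z"
    by (rule perpendiculars_diverge[OF _ _ refl \<Delta>]) (use base[of _ _] u1 u2 \<Delta> in simp_all)
  moreover have "height ?z + height ?y - min (height ?z) (height ?y) / 2 - 2 * (24 * \<Delta>) \<le> dist ?z ?y"
    by (rule perpendiculars_diverge[OF _ _ refl \<Delta>]) (use base[of _ _] u2 u3 \<Delta> in simp_all)
  moreover have "dist ?x ?y \<le> height ?x + 2 * \<Delta> + height ?y"
    using dist_le_via_geodesic[of ?x ?y] u1 u3 \<Delta> by simp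
  \<comment> \<open>Both minima are at most the height of \<open>?z\<close>, so of its two copies
    one survives; \<open>98 = 2 + 2 * 48\<close>.\<close>
  ultimately have "height ?z \<le> 98 * \<Delta>"
    using d min.cobounded2[of "height ?x" "height ?z"] min.cobounded1[of "height ?z" "height ?y"]
    by linarith
  moreover have "?z \<in> S" using c(2) u1 u2 by auto
  ultimately show thesis using that[of ?z] u2 \<Delta> by simp
qed

text \<open>Along three consecutive geodesics in \<open>g\<close> the foot advances from
  \<open>p\<close> to \<open>p + 6 * \<Delta>\<close>, so one of them traverses a third of this
  interval in the positive direction.\<close>

lemma curtain_passes_near:
  assumes base: "\<And>x y. \<lbrakk>foot I a x \<in> {p..q}; foot I a y \<in> {p..q};
      \<bar>foot I a x - foot I a y\<bar> = \<Delta>; height x = 24 * \<Delta>; height y = 24 * \<Delta>\<rbrakk>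
      \<Longrightarrow> 48 * \<Delta> \<le> dist x y"
    and \<Delta>: "0 < \<Delta>" "p + 6 * \<Delta> \<le> q"
    and g: "is_curtain g" "x \<in> g" "y \<in> g" "foot I a x \<le> p" "q \<le> foot I a y"
  obtains z where "z \<in> g" "p \<le> foot I a z" "foot I a z \<le> q" "height z \<le> 98 * \<Delta>"
proof -
  obtain x1 x2 where j: "joined_in g x x1" "joined_in g x1 x2" "joined_in g x2 y"
    using curtain_three_geodesics[OF g(1-3)] .
  have "\<exists>p' v w. p \<le> p' \<and> p' + 2 * \<Delta> \<le> q \<and> joined_in g v w \<and> foot I a v \<le> p' \<and>
      p' + 2 * \<Delta> \<le> foot I a w"
  proof -
    consider "p + 2 * \<Delta> \<le> foot I a x1" | "foot I a x1 \<le> p + 2 * \<Delta>" "p + 4 * \<Delta> \<le> foot I a x2"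
      | "foot I a x2 \<le> p + 4 * \<Delta>" by linarith
    then show ?thesis
    proof cases
      case 1
      then show ?thesis using j g \<Delta> by (intro exI[of _ p] exI[of _ x] exI[of _ x1]) auto
    next
      case 2
      then show ?thesis using j g \<Delta>
        by (intro exI[of _ "p + 2 * \<Delta>"] exI[of _ x1] exI[of _ x2]) auto
    next
      case 3
      then show ?thesis using j g \<Delta>
        by (intro exI[of _ "p + 4 * \<Delta>"] exI[of _ x2] exI[of _ y]) auto
    qed
  qed
  then obtain p' v w where p': "p \<le> p'" "p' + 2 * \<Delta> \<le> q" "joined_in g v w"
    "foot I a v \<le> p'" "p' + 2 * \<Delta> \<le> foot I a w" by blast
  have base': "48 * \<Delta> \<le> dist x y"
    if "foot I a x \<in> {p'..p' + 2 * \<Delta>}" "foot I a y \<in> {p'..p' + 2 * \<Delta>}"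
      "\<bar>foot I a x - foot I a y\<bar> = \<Delta>" "height x = 24 * \<Delta>" "height y = 24 * \<Delta>" for x y
    by (rule base) (use that p'(1,2) in auto)
  obtain z where "z \<in> g" "p' \<le> foot I a z" "foot I a z \<le> p' + 2 * \<Delta>" "height z \<le> 98 * \<Delta>"
    by (rule geodesic_passes_near[OF _ \<Delta>(1) p'(3-5)]) (rule base'; assumption)
  then show thesis using that[of z] p'(1,2) by simp
qed

end

section \<open>Nested half spaces\<close>

context curtain_chain_sides
begin

text \<open>The connected set \<open>A i \<union> g i\<close> misses \<open>g j\<close>, which lies
  in \<open>B i\<close>, and it meets \<open>A j\<close> in \<open>g i\<close>.\<close>

lemma A_subset:
  assumes "i - 1 \<in> J" "i \<in> J" "j \<in> J" "j + 1 \<in> J" "i < j"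
  shows "A i \<subseteq> A j"
proof -
  have J: "i + 1 \<in> J" "j - 1 \<in> J" using index_between[OF assms(2,3)] assms(5) by auto
  note si = sides_at[OF assms(1,2) J(1)] and sj = sides_at[OF J(2) assms(3,4)]
  have 1: "g j \<subseteq> B i" "g i \<subseteq> A j"
    using after_all[OF assms(2,3,1,5)] before_all[OF assms(2,3,4,5)] by auto
  then have "(A i \<union> g i) \<inter> g j = {}" using sides_disjoint[OF si] by blast
  then have "A i \<union> g i \<subseteq> A j \<or> A i \<union> g i \<subseteq> B j"
    by (rule sides_connected_cases[OF sj sides_connected_Un[OF si]])
  moreover have "g i \<noteq> {}" by (rule sides_nonempty[OF si])
  ultimately show ?thesis using 1 sides_disjoint(3)[OF sj] by blast
qed

lemma B_subset:
  assumes "i - 1 \<in> J" "i \<in> J" "j \<in> J" "j + 1 \<in> J" "i < j"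
  shows "B j \<subseteq> B i"
proof -
  have J: "i + 1 \<in> J" "j - 1 \<in> J" using index_between[OF assms(2,3)] assms(5) by auto
  note si = sides_at[OF assms(1,2) J(1)] and sj = sides_at[OF J(2) assms(3,4)]
  have 1: "g j \<subseteq> B i" "g i \<subseteq> A j"
    using after_all[OF assms(2,3,1,5)] before_all[OF assms(2,3,4,5)] by auto
  then have "(B j \<union> g j) \<inter> g i = {}" using sides_disjoint[OF sj] by blast
  then have "B j \<union> g j \<subseteq> A i \<or> B j \<union> g j \<subseteq> B i"
    by (rule sides_connected_cases[OF si sides_connected_Un[OF sides_commute[OF sj]]])
  moreover have "g j \<noteq> {}" by (rule sides_nonempty[OF sj])
  ultimately show ?thesis using 1 sides_disjoint(3)[OF si] by blast
qed

end

text \<open>Stewart's inequality at \<open>v\<close> between the foot and \<open>d\<close>, combined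
  with the obtuse angle at the foot, makes the distance strictly smaller before
  \<open>d\<close>.\<close>

lemma (in cat0_geodesic) dist_less_beyond_foot:
  assumes "foot I a x \<le> v" "v < d" "d \<in> I"
  shows "dist x (a v) < dist x (a d)"
proof -
  let ?f = "foot I a x"
  have f: "?f < d" using assms by simp
  have "(d - ?f) * (dist x (a v))\<^sup>2 \<le> (d - v) * (dist x (a ?f))\<^sup>2 + (v - ?f) * (dist x (a d))\<^sup>2
      - (d - ?f) * (v - ?f) * (d - v)"
    by (rule stewart) (use assms foot_in in auto)
  moreover have "(d - v) * (dist x (a ?f))\<^sup>2 \<le> (d - v) * ((dist x (a d))\<^sup>2 - (d - ?f)\<^sup>2)"
    using obtuse[OF assms(3), of x] assms by (intro mult_left_mono) auto
  moreover have "0 < (d - v) * (d - ?f)\<^sup>2" using assms f by simp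
  moreover have "0 \<le> (d - ?f) * (v - ?f) * (d - v)" using assms f by simp
  ultimately have "(d - ?f) * (dist x (a v))\<^sup>2 < (d - ?f) * (dist x (a d))\<^sup>2"
    by (simp add: algebra_simps)
  then have "(dist x (a v))\<^sup>2 < (dist x (a d))\<^sup>2" using f by simp
  then show ?thesis by (rule power2_less_imp_less) simp
qed

section \<open>Rays and the feet of nearby points\<close>

locale cat0_ray = sublinear \<kappa> for \<kappa> +
  fixes b :: "real \<Rightarrow> 'a::cat0_space"
  assumes ray: "geodesic_on {0..} b"
begin

sublocale cat0_geodesic "{0..}" b
  by standard (use ray in auto)

abbreviation ft :: "'a \<Rightarrow> real" where "ft \<equiv> foot {0..} b"

lemma ft_nonneg: "0 \<le> ft x"
  using foot_in[of x] by simp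

lemma interval_interior: "1/2 < r \<Longrightarrow> {r - 1/2..r + 1/2} \<subseteq> interior {0::real..}"
  by (rule order_trans[of _ "{0<..}"]) (auto intro!: interior_maximal)

lemma contracting_foot:
  assumes H: "\<And>x \<rho>. 0 < \<rho> \<Longrightarrow> ball x \<rho> \<inter> b ` {0..} = {} \<Longrightarrow>
      diameter (closest_proj (b ` {0..}) ` ball x \<rho>) < C * \<kappa> (dist (b 0) x)"
    and y: "dist x y < height x"
  shows "\<bar>ft x - ft y\<bar> < C * \<kappa> (dist (b 0) x)"
proof -
  let ?P = "closest_proj (b ` {0..}) ` ball x (height x)"
  have h: "0 < height x" using y zero_le_dist[of x y] by linarith
  have "ball x (height x) \<inter> b ` {0..} = {}" using foot_le[of _ x] by fastforce
  then have D: "diameter ?P < C * \<kappa> (dist (b 0) x)" by (rule H[OF h])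
  \<comment> \<open>Boundedness has to be known first: \<open>diameter\<close> says something about
    distances only for bounded sets.\<close>
  have "dist (b (ft x)) z \<le> height x" if z: "z \<in> ?P" for z
  proof -
    obtain w where "w \<in> ball x (height x)" "z = b (ft w)" using z by (auto simp: closest_proj_eq)
    then show ?thesis using dist_geodesic[OF foot_in[of x] foot_in[of w]] foot_lipschitz[of x w] by simp
  qed
  then have "bounded ?P" unfolding bounded_def by blast
  moreover have "b (ft x) \<in> ?P" "b (ft y) \<in> ?P"
    using h y by (auto simp: closest_proj_eq)
  ultimately have "dist (b (ft x)) (b (ft y)) \<le> diameter ?P" by (rule diameter_bounded_bound)
  then show ?thesis using D dist_geodesic[OF foot_in[of x] foot_in[of y]] by simp
qed

text \<open>Otherwise the midpoint \<open>m\<close> lies in both balls of radius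
  \<open>\<rho>\<close>, and contraction puts its foot close to both feet. The centres are within
  \<open>T + \<rho> \<le> 2 * T\<close> of \<open>b 0\<close>, whence the bound
  \<open>2 * C * \<kappa> T\<close> for each.\<close>

lemma contracting_disjoint_balls:
  assumes H: "\<And>x \<rho>. 0 < \<rho> \<Longrightarrow> ball x \<rho> \<inter> b ` {0..} = {} \<Longrightarrow>
      diameter (closest_proj (b ` {0..}) ` ball x \<rho>) < C * \<kappa> (dist (b 0) x)"
    and C: "0 \<le> C" and \<rho>: "\<rho> \<le> T"
    and x: "ft x \<le> T" "height x = \<rho>" and y: "ft y \<le> T" "height y = \<rho>"
    and far: "4 * C * \<kappa> T \<le> \<bar>ft x - ft y\<bar>"
  shows "2 * \<rho> \<le> dist x y"
proof (rule ccontr)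
  assume less: "\<not> 2 * \<rho> \<le> dist x y"
  obtain c where c: "geodesic_joining c x y" using ex_geodesic by blast
  interpret c: cat0_geodesic "{0..dist x y}" c
    by standard (use c in \<open>auto simp: geodesic_joining_def\<close>)
  define m where "m = c (dist x y / 2)"
  have c0: "c 0 = x" "c (dist x y) = y" using c by (auto simp: geodesic_joining_def)
  have m: "dist x m = dist x y / 2" "dist y m = dist x y / 2"
    using c.dist_geodesic[of 0 "dist x y / 2"] c.dist_geodesic[of "dist x y" "dist x y / 2"] c0
    by (auto simp: m_def)
  have T: "0 \<le> T" using x ft_nonneg[of x] by linarith
  have *: "\<bar>ft z - ft m\<bar> < 2 * C * \<kappa> T" if z: "ft z \<le> T" "height z = \<rho>" "dist z m < \<rho>" for z
  proof -
    have "dist (b 0) z \<le> dist (b 0) (b (ft z)) + dist z (b (ft z))" by (rule dist_triangle2)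
    also have "dist (b 0) (b (ft z)) = ft z"
      using dist_geodesic[of 0 "ft z"] foot_in[of z] by simp
    finally have "\<kappa> (dist (b 0) z) \<le> 2 * \<kappa> T"
      using z \<rho> by (intro kappa_le_double[OF T]) auto
    then have "C * \<kappa> (dist (b 0) z) \<le> C * (2 * \<kappa> T)" using C by (rule mult_left_mono)
    moreover have "\<bar>ft z - ft m\<bar> < C * \<kappa> (dist (b 0) z)"
      by (rule contracting_foot) (use H z in auto)
    ultimately show ?thesis by simp
  qed
  have "\<bar>ft x - ft m\<bar> < 2 * C * \<kappa> T" "\<bar>ft y - ft m\<bar> < 2 * C * \<kappa> T"
    using * x y m less by auto
  then show False using far by linarith
qed

section \<open>From contraction to chains\<close>

lemma contracting_imp_chain:
  assumes "contracting (b 0) \<kappa> b"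
  shows "\<exists>C>0. \<exists>(h :: int \<Rightarrow> 'a set) (t :: int \<Rightarrow> real).
       curtain_chain {1..} h \<and>
       (\<forall>i\<ge>1. 0 \<le> t i \<and> b (t i) \<in> h i \<and>
          t (i + 1) - t i \<le> C * \<kappa> (t (i + 1)) \<and>
          L_separated (C * \<kappa> (t (i + 1))) (h i) (h (i + 1)))"
proof -
  obtain C where C: "0 \<le> C" and H: "\<And>x \<rho>. 0 < \<rho> \<Longrightarrow> ball x \<rho> \<inter> b ` {0..} = {} \<Longrightarrow>
      diameter (closest_proj (b ` {0..}) ` ball x \<rho>) < C * \<kappa> (dist (b 0) x)"
    using assms unfolding contracting_def by blast
  \<comment> \<open>So that \<open>M * \<kappa> T\<close> exceeds the separation
    \<open>4 * C * \<kappa> T\<close> of feet asked for above, and is at least 1 even if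
    \<open>C = 0\<close>.\<close>
  define M where "M = 4 * C + 1"
  have M: "1 \<le> M" using C by (simp add: M_def)
  \<comment> \<open>Beyond \<open>T0\<close> the height \<open>24 * \<Delta>\<close> stays below
    \<open>T\<close>, and consecutive parameters differ by a factor of at most 2.\<close>
  obtain T0 where T0: "0 < T0" "\<And>t. T0 \<le> t \<Longrightarrow> 24 * M * \<kappa> t \<le> t"
    using kappa_eventually_le[of "24 * M"] M by auto
  \<comment> \<open>Since \<open>\<Delta>\<close> is at most twice
    \<open>M * \<kappa> (t i)\<close>, the factor 13 leaves room for \<open>6 * \<Delta>\<close> and
    for the two half widths of the curtains.\<close>
  define r :: "nat \<Rightarrow> real" where "r = rec_nat (T0 + 1) (\<lambda>_ v. v + 13 * M * \<kappa> v)"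
  have r_Suc: "r (Suc n) = r n + 13 * (M * \<kappa> (r n))" for n by (simp add: r_def)
  have Mk: "1 \<le> M * \<kappa> v" if "0 \<le> v" for v
    using mult_mono[OF M kappa_ge_1[OF that]] M by simp
  have r_ge: "T0 + 1 \<le> r n" for n
  proof (induction n)
    case (Suc n)
    then show ?case using Mk[of "r n"] T0(1) by (simp add: r_Suc)
  qed (simp add: r_def)
  have r0: "0 \<le> r n" for n using r_ge[of n] T0(1) by linarith
  have r_less: "r m + 1 < r n" if "m < n" for m n
    using that
  proof (induction n)
    case (Suc n)
    have "r n + 1 < r (Suc n)" using Mk[OF r0[of n]] by (simp add: r_Suc)
    then show ?case using Suc by (cases "m = n") auto
  qed simp
  define t where "t i = r (nat i)" for i :: int
  define h where "h i = dual_curtain {0..} b (t i)" for i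
  have t_less: "t i + 1 < t j" if "i \<in> {1..}" "i < j" for i j
    using r_less[of "nat i" "nat j"] that by (simp add: t_def)
  have t_ge: "T0 + 1 \<le> t i" for i using r_ge by (simp add: t_def)
  have t_int: "{t i - 1/2..t i + 1/2} \<subseteq> interior {0..}" for i
    using t_ge[of i] T0(1) by (intro interval_interior) linarith
  have h_eq: "h i = {x. t i - 1/2 \<le> ft x \<and> ft x \<le> t i + 1/2}" for i
    unfolding h_def by (rule dual_curtain_eq) (use t_int[of i] interior_subset in blast)
  have chain: "curtain_chain {1..} h"
    unfolding h_def by (rule dual_curtain_chain) (use t_int t_less in auto)
  have sep: "L_separated (211 * M * \<kappa> (t (i + 1))) (h i) (h (i + 1))"
    and gap: "t (i + 1) - t i \<le> 211 * M * \<kappa> (t (i + 1))" if i: "1 \<le> i" for i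
  proof -
    define T where "T = t (i + 1)"
    define \<Delta> where "\<Delta> = M * \<kappa> T"
    have "nat (i + 1) = Suc (nat i)" using i by simp
    then have T: "T = t i + 13 * (M * \<kappa> (t i))" by (simp add: T_def t_def r_Suc)
    have ti: "0 \<le> t i" "T0 \<le> t i" using t_ge[of i] T0(1) by auto
    have "24 * (M * \<kappa> (t i)) \<le> t i" using T0(2)[OF ti(2)] by simp
    then have T2: "t i \<le> T" "T \<le> 2 * t i" using T Mk[OF ti(1)] by auto
    have "\<kappa> (t i) \<le> \<kappa> T" "\<kappa> T \<le> 2 * \<kappa> (t i)"
      using kappa_mono[OF ti(1) T2(1)] kappa_le_double[OF ti(1) _ T2(2)] T2 ti by auto
    then have "M * \<kappa> (t i) \<le> \<Delta>" "\<Delta> \<le> M * (2 * \<kappa> (t i))"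
      unfolding \<Delta>_def using M by (auto intro!: mult_left_mono)
    then have \<Delta>: "M * \<kappa> (t i) \<le> \<Delta>" "\<Delta> \<le> 2 * (M * \<kappa> (t i))" by auto
    have \<Delta>1: "1 \<le> \<Delta>" using \<Delta> Mk[OF ti(1)] by linarith
    have \<Delta>T: "24 * \<Delta> \<le> T" using T0(2)[of T] T2 ti by (simp add: \<Delta>_def)
    show "t (i + 1) - t i \<le> 211 * M * \<kappa> (t (i + 1))"
      using T \<Delta> \<Delta>1 unfolding T_def[symmetric] by (simp add: \<Delta>_def)
    have base: "48 * \<Delta> \<le> dist x y"
      if "ft x \<in> {t i + 1/2..T - 1/2}" "ft y \<in> {t i + 1/2..T - 1/2}"
        "\<bar>ft x - ft y\<bar> = \<Delta>" "height x = 24 * \<Delta>" "height y = 24 * \<Delta>" for x y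
    proof -
      have "4 * C * \<kappa> T \<le> \<Delta>"
        using kappa_ge_1[of T] ti T2 by (simp add: \<Delta>_def M_def algebra_simps)
      then have "2 * (24 * \<Delta>) \<le> dist x y"
        by (intro contracting_disjoint_balls[OF _ C \<Delta>T _ that(4) _ that(5)])
          (use H that in auto)
      then show ?thesis by simp
    qed
    have wide: "t i + 1/2 + 6 * \<Delta> \<le> T - 1/2" using \<Delta> T Mk[OF ti(1)] by linarith
    have "finite (g ` J) \<and> real (card (g ` J)) \<le> 211 * M * \<kappa> T"
      if g: "curtain_chain J g" "chain_meets J g (h i)" "chain_meets J g (h (i + 1))" for J g
    proof -
      obtain A B where "curtain_chain_sides J g A B" using curtain_chain_sidesE[OF g(1)] .
      then interpret G: curtain_chain_sides J g A B .
      have "\<exists>z. z \<in> g m \<and> t i + 1/2 \<le> ft z \<and> ft z \<le> T - 1/2 \<and> height z \<le> 98 * \<Delta>"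
        if m: "m \<in> J" for m
      proof -
        obtain x y where x: "x \<in> g m" "x \<in> h i" and y: "y \<in> g m" "y \<in> h (i + 1)"
          using g(2,3) m unfolding chain_meets_def by blast
        have "is_curtain (g m)" using g(1) m unfolding curtain_chain_def by blast
        moreover have "ft x \<le> t i + 1/2" "T - 1/2 \<le> ft y"
          using x y by (auto simp: h_eq T_def)
        ultimately obtain z where "z \<in> g m" "t i + 1/2 \<le> ft z" "ft z \<le> T - 1/2" "height z \<le> 98 * \<Delta>"
          by (rule curtain_passes_near[OF _ _ wide _ x(1) y(1), rotated 2])
            ((rule base; assumption) | (use \<Delta>1 in simp))+
        then show ?thesis by blast
      qed
      then obtain z where z: "\<And>m. m \<in> J \<Longrightarrow> z m \<in> g m \<and> t i + 1/2 \<le> ft (z m) \<and>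
          ft (z m) \<le> T - 1/2 \<and> height (z m) \<le> 98 * \<Delta>" by metis
      \<comment> \<open>Two heights of at most \<open>98 * \<Delta>\<close> and a horizontal part of
        at most \<open>13 * \<Delta>\<close> make 209. The two extra units are at most
        \<open>2 * \<Delta>\<close>, which gives 211.\<close>
      have "real_of_int (k - j) \<le> 209 * \<Delta> + 1" if jk: "j \<in> J" "k \<in> J" "j < k" for j k
      proof -
        have "real_of_int (k - j) - 1 \<le> dist (z j) (z k)"
          using G.chain_dist[OF jk] z jk by blast
        also have "\<dots> \<le> height (z j) + \<bar>ft (z j) - ft (z k)\<bar> + height (z k)"
          by (rule dist_le_via_geodesic)
        also have "\<bar>ft (z j) - ft (z k)\<bar> \<le> 13 * \<Delta>"
          using z[OF jk(1)] z[OF jk(2)] T \<Delta> by linarith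
        finally show ?thesis using z[OF jk(1)] z[OF jk(2)] by linarith
      qed
      then have "finite J \<and> real (card J) \<le> 209 * \<Delta> + 1 + 1"
        by (rule card_int_set_bounded) (use \<Delta>1 in auto)
      moreover from this have "card (g ` J) \<le> card J" by (simp add: card_image_le)
      ultimately show ?thesis using \<Delta>1 by (simp add: \<Delta>_def)
    qed
    moreover have "is_curtain (h i)" "is_curtain (h (i + 1))"
      using chain i unfolding curtain_chain_def by auto
    moreover have "h i \<inter> h (i + 1) = {}" using t_less[of i "i + 1"] i by (auto simp: h_eq)
    ultimately show "L_separated (211 * M * \<kappa> (t (i + 1))) (h i) (h (i + 1))"
      unfolding L_separated_def T_def by blast
  qed
  have "b (t i) \<in> h i" "0 \<le> t i" for i
    using t_ge[of i] T0(1) foot_self[of "t i"] by (auto simp: h_eq)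
  then show ?thesis
    using chain sep gap M by (intro exI[of _ "211 * M"] exI[of _ h] exI[of _ t] conjI allI impI) auto
qed

end

section \<open>From chains to contraction\<close>

text \<open>
  Let \<open>w\<close> be the point of the geodesic closest to \<open>a t\<close>. Curtains dual to \<open>[w, a t]\<close> miss the
  geodesic, and one of the two halves of \<open>a\<close> at \<open>a t\<close> lies on the far side of all of them, since
  the two halves cannot both make an acute angle with \<open>[a t, w]\<close>. So these curtains meet two
  consecutive curtains of the three.
\<close>

lemma (in cat0_geodesic) bottleneck:
  assumes c: "geodesic_joining c x y"
    and z: "z0 \<in> c ` {0..dist x y}" "z1 \<in> c ` {0..dist x y}" "z2 \<in> c ` {0..dist x y}"
    and h: "z0 \<in> h0" "z1 \<in> h1" "z2 \<in> h2"
    and u: "a u0 \<in> h0" "a t \<in> h1" "a u2 \<in> h2"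
    and ut: "u0 < t" "t < u2" and I: "u0 \<in> I" "t \<in> I" "u2 \<in> I"
    and sep: "L_separated L0 h0 h1" "L_separated L1 h1 h2" "L0 \<le> L" "L1 \<le> L"
  obtains w where "w \<in> c ` {0..dist x y}" "dist (a t) w \<le> 2 * L + 4"
proof -
  interpret c: cat0_geodesic "{0..dist x y}" c
    by standard (use c in \<open>auto simp: geodesic_joining_def\<close>)
  define p where "p = a t"
  define w where "w = c (foot {0..dist x y} c p)"
  define d where "d = dist w p"
  obtain e where e: "geodesic_joining e w p" using ex_geodesic by blast
  interpret e: cat0_geodesic "{0..d}" e
    by standard (use e in \<open>auto simp: geodesic_joining_def d_def\<close>)
  have e0: "e 0 = w" "e d = p" using e by (auto simp: geodesic_joining_def d_def)
  have d: "0 \<le> d" by (simp add: d_def)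
  \<comment> \<open>Each \<open>e s\<close> projects to \<open>w\<close> on the geodesic
    \<open>c\<close>, so the obtuse angle there makes \<open>w\<close> at least as close to
    \<open>c v\<close> as \<open>e s\<close> is.\<close>
  have far: "foot {0..d} e (c v) = 0" if v: "v \<in> {0..dist x y}" for v
  proof (rule e.foot_eqI)
    fix s assume s: "s \<in> {0..d}"
    have f: "foot {0..dist x y} c (e s) = foot {0..dist x y} c p"
      by (rule c.foot_on_perpendicular(1)) (use e s in \<open>auto simp: w_def d_def dist_commute\<close>)
    have "(v - foot {0..dist x y} c p)\<^sup>2 \<le> (dist (e s) (c v))\<^sup>2"
      using c.obtuse[OF v, of "e s"] unfolding f by (smt (verit) zero_le_power2)
    then have "\<bar>v - foot {0..dist x y} c p\<bar> \<le> dist (e s) (c v)"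
      by - (rule power2_le_imp_le; simp)
    then show "dist (c v) (e 0) \<le> dist (c v) (e s)"
      using c.dist_geodesic[OF v c.foot_in[of p]] e0 by (simp add: w_def dist_commute)
  qed (use d in simp)
  have fp: "foot {0..d} e p = d" using e.foot_self[of d] e0 d by simp
  have "foot {0..d} e (a u0) = d \<or> foot {0..d} e (a u2) = d"
  proof (rule ccontr)
    assume "\<not> ?thesis"
    then have less: "foot {0..d} e (a u0) < d" "foot {0..d} e (a u2) < d"
      using e.foot_in[of "a u0"] e.foot_in[of "a u2"] by auto
    \<comment> \<open>At this common parameter both distances have dropped strictly, so
      \<open>e ?v\<close> would be a shortcut between \<open>a u0\<close> and \<open>a u2\<close>,
      whose geodesic passes through \<open>p\<close>.\<close>
    let ?v = "max (foot {0..d} e (a u0)) (foot {0..d} e (a u2))"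
    have "dist (a u0) (e ?v) < dist (a u0) (e d)" "dist (a u2) (e ?v) < dist (a u2) (e d)"
      using less d by (auto intro!: e.dist_less_beyond_foot)
    moreover have "dist (a u0) (a u2) \<le> dist (a u0) (e ?v) + dist (a u2) (e ?v)"
      by (rule dist_triangle2)
    moreover have "dist (a u0) p = t - u0" "dist (a u2) p = u2 - t" "dist (a u0) (a u2) = u2 - u0"
      using dist_geodesic I ut by (auto simp: p_def)
    ultimately show False using e0 by simp
  qed
  then have "d \<le> 2 * L + 4"
  proof
    assume u0: "foot {0..d} e (a u0) = d"
    have "d - 0 \<le> 2 * L0 + 4"
      by (rule e.L_separated_length_bound[OF sep(1) h(1) u(1) _ _ h(2) u(2)])
        (use z far fp u0 in \<open>auto simp: p_def\<close>)
    then show ?thesis using sep(3) by simp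
  next
    assume u2: "foot {0..d} e (a u2) = d"
    have "d - 0 \<le> 2 * L1 + 4"
      by (rule e.L_separated_length_bound[OF sep(2) h(2) u(2) _ _ h(3) u(3)])
        (use z far fp u2 in \<open>auto simp: p_def\<close>)
    then show ?thesis using sep(4) by simp
  qed
  then show thesis
    using that[of w] c.foot_in[of p] by (auto simp: w_def d_def p_def dist_commute)
qed

section \<open>A ray meeting a separated chain\<close>

locale ray_with_chain = cat0_ray \<kappa> b + curtain_chain_sides "{1..}" h A B
  for \<kappa> and b :: "real \<Rightarrow> 'a::cat0_space" and h A B +
  fixes C :: real and t :: "int \<Rightarrow> real"
  assumes C_pos: "0 < C"
    and t_nonneg: "1 \<le> i \<Longrightarrow> 0 \<le> t i"
    and t_in: "1 \<le> i \<Longrightarrow> b (t i) \<in> h i"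
    and t_step: "1 \<le> i \<Longrightarrow> t (i + 1) - t i \<le> C * \<kappa> (t (i + 1))"
    and separated: "1 \<le> i \<Longrightarrow> L_separated (C * \<kappa> (t (i + 1))) (h i) (h (i + 1))"
begin

text \<open>The parameters are not assumed to increase, but the widths of the curtains force them to
  infinity. This gives the late and the last indices below.\<close>

lemma t_lower:
  assumes "1 \<le> i" shows "real_of_int i - 2 - t 1 \<le> t i"
proof (cases "i = 1")
  case True
  then show ?thesis using t_nonneg[of 1] by simp
next
  case False
  then have "real_of_int (i - 1) - 1 \<le> dist (b (t 1)) (b (t i))"
    using assms t_in by (intro chain_dist) auto
  also have "\<dots> = \<bar>t 1 - t i\<bar>" using assms t_nonneg by (intro dist_geodesic) auto
  finally show ?thesis using t_nonneg[of 1] t_nonneg[OF assms] by linarith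
qed

lemma ex_late:
  obtains n where "k < n" "1 \<le> n" "v \<le> t n"
proof -
  define n where "n = max (max (k + 1) 1) \<lceil>v + 2 + t 1\<rceil>"
  have n: "k < n" "1 \<le> n" "\<lceil>v + 2 + t 1\<rceil> \<le> n" by (auto simp: n_def)
  then have "v + 2 + t 1 \<le> real_of_int n" by linarith
  then show thesis using that[of n] n t_lower[of n] by linarith
qed

lemma ex_last:
  assumes "t 1 \<le> \<tau>"
  obtains i where "1 \<le> i" "t i \<le> \<tau>" "\<And>k. i < k \<Longrightarrow> \<tau> < t k"
proof -
  define S where "S = {i. 1 \<le> i \<and> t i \<le> \<tau>}"
  have "S \<subseteq> {1..\<lceil>\<tau> + 2 + t 1\<rceil>}"
  proof
    fix i assume "i \<in> S"
    then have "1 \<le> i" "real_of_int i \<le> \<tau> + 2 + t 1"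
      using t_lower[of i] by (auto simp: S_def)
    then show "i \<in> {1..\<lceil>\<tau> + 2 + t 1\<rceil>}" by (auto, linarith)
  qed
  then have fin: "finite S" using finite_subset by blast
  have ne: "S \<noteq> {}" using assms by (auto simp: S_def)
  have "Max S \<in> S" using fin ne by (rule Max_in)
  moreover have "\<tau> < t k" if "Max S < k" for k
  proof (rule ccontr)
    assume "\<not> \<tau> < t k"
    then have "k \<in> S" using that \<open>Max S \<in> S\<close> by (auto simp: S_def)
    then show False using Max_ge[OF fin] that by fastforce
  qed
  ultimately show thesis using that[of "Max S"] by (auto simp: S_def)
qed

text \<open>If \<open>x\<close> is outside \<open>A (i + 1)\<close>, it is outside
  \<open>A i\<close> too. The connected set of points with foot in \<open>{0..s}\<close> contains
  \<open>x\<close> and \<open>b (t 1)\<close>, so both \<open>h i\<close> and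
  \<open>h (i + 1)\<close> reach back to it. They also contain points of \<open>b\<close> beyond
  \<open>\<tau>\<close>, against their separation.\<close>

lemma in_A:
  assumes i: "2 \<le> i" and s: "ft x \<le> s" "t 1 \<le> s" and \<tau>: "\<tau> \<le> t i" "\<tau> \<le> t (i + 1)"
    and L: "C * \<kappa> (t (i + 1)) \<le> L" "2 * L + 4 < \<tau> - s"
  shows "x \<in> A (i + 1)"
proof (rule ccontr)
  assume notin: "x \<notin> A (i + 1)"
  then have "x \<notin> A i" using A_subset[of i "i + 1"] i by auto
  have near: "\<exists>y\<in>h k. ft y \<le> s" if k: "2 \<le> k" "x \<notin> A k" for k
  proof -
    have sk: "sides (h k) (A k) (B k)" using sides_at[of k] k by simp
    show ?thesis
    proof (cases "x \<in> h k")
      case False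
      let ?Z = "{y. ft y \<in> {0..s}}"
      have "x \<in> ?Z \<inter> B k" using False k sides_cover[OF sk] s ft_nonneg by auto
      moreover have "b (t 1) \<in> A k" using before_all[of 1 k] k t_in[of 1] by auto
      then have "b (t 1) \<in> ?Z \<inter> A k" using t_nonneg[of 1] s by (auto simp: foot_self)
      moreover have "connected ?Z" by (rule connected_foot_vimage) (auto simp: is_interval_cc)
      ultimately have "?Z \<inter> h k \<noteq> {}" by (intro sides_cross[OF sk]) auto
      then show ?thesis by auto
    qed (use s in auto)
  qed
  obtain y y' where y: "y \<in> h i" "ft y \<le> s" "y' \<in> h (i + 1)" "ft y' \<le> s"
    using near[of i] near[of "i + 1"] i notin \<open>x \<notin> A i\<close> by auto
  have "\<tau> - s \<le> 2 * (C * \<kappa> (t (i + 1))) + 4"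
    by (rule L_separated_length_bound[OF separated y(1) t_in y(2) _ y(3) t_in y(4)])
      (use i \<tau> t_nonneg[of i] t_nonneg[of "i + 1"] t_nonneg[of 1] s in \<open>auto simp: foot_self\<close>)
  then show False using L by linarith
qed

text \<open>The mirror image, with \<open>b (t n)\<close> for a late \<open>n\<close> in place of
  \<open>b (t 1)\<close>.\<close>

lemma in_B:
  assumes i: "2 \<le> i" and s: "s \<le> ft y" "0 \<le> \<tau>" and \<tau>: "t i \<le> \<tau>" "t (i + 1) \<le> \<tau>"
    and L: "C * \<kappa> (t (i + 1)) \<le> L" "2 * L + 4 < s - \<tau>" "0 \<le> L"
  shows "y \<in> B i"
proof (rule ccontr)
  assume notin: "y \<notin> B i"
  then have "y \<notin> B (i + 1)" using B_subset[of i "i + 1"] i by auto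
  have near: "\<exists>x\<in>h k. s \<le> ft x" if k: "2 \<le> k" "y \<notin> B k" for k
  proof -
    have sk: "sides (h k) (A k) (B k)" using sides_at[of k] k by simp
    show ?thesis
    proof (cases "y \<in> h k")
      case False
      let ?Z = "{x. ft x \<in> {s..}}"
      obtain n where n: "k < n" "1 \<le> n" "s \<le> t n" using ex_late .
      have "y \<in> ?Z \<inter> A k" using False k sides_cover[OF sk] s by auto
      moreover have "b (t n) \<in> B k" using after_all[of k n] k t_in[of n] n by auto
      then have "b (t n) \<in> ?Z \<inter> B k" using t_nonneg[of n] n by (auto simp: foot_self)
      moreover have "connected ?Z"
        by (rule connected_foot_vimage) (use s L in \<open>auto simp: is_interval_ci\<close>)
      ultimately have "?Z \<inter> h k \<noteq> {}" by (intro sides_cross[OF sk]) auto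
      then show ?thesis by auto
    qed (use s in auto)
  qed
  obtain x x' where x: "x \<in> h i" "s \<le> ft x" "x' \<in> h (i + 1)" "s \<le> ft x'"
    using near[of i] near[of "i + 1"] i notin \<open>y \<notin> B (i + 1)\<close> by auto
  have "s - \<tau> \<le> 2 * (C * \<kappa> (t (i + 1))) + 4"
    by (rule L_separated_length_bound[OF separated t_in x(1) _ x(2) t_in x(3) _ x(4)])
      (use i \<tau> t_nonneg[of i] t_nonneg[of "i + 1"] s in \<open>auto simp: foot_self\<close>)
  then show False using L by linarith
qed

lemma geodesic_near_ray:
  assumes j: "3 \<le> j" and tj: "t 1 < t j"
    and xy: "\<And>k. k \<in> {j - 1..j + 1} \<Longrightarrow> x \<in> A k \<and> y \<in> B k"
    and L: "C * \<kappa> (t j) \<le> L" "C * \<kappa> (t (j + 1)) \<le> L"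
  shows "dist x (b (t j)) + dist y (b (t j)) \<le> dist x y + 4 * L + 8"
proof -
  obtain c where c: "geodesic_joining c x y" using ex_geodesic by blast
  note Z = connected_geodesic_image[OF c]
  have "\<exists>z. z \<in> c ` {0..dist x y} \<and> z \<in> h k" if k: "k \<in> {j - 1..j + 1}" for k
  proof -
    have "sides (h k) (A k) (B k)" using sides_at[of k] j k by simp
    then have "c ` {0..dist x y} \<inter> h k \<noteq> {}"
      by (rule sides_cross) (use Z xy[OF k] in auto)
    then show ?thesis by blast
  qed
  then obtain z where z: "\<And>k. k \<in> {j - 1..j + 1} \<Longrightarrow> z k \<in> c ` {0..dist x y} \<and> z k \<in> h k"
    by metis
  \<comment> \<open>As \<open>t (j - 1)\<close> and \<open>t (j + 1)\<close> may lie on the wrong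
    side of \<open>t j\<close>, other points of \<open>b\<close> in the neighbouring curtains are
    found by crossing.\<close>
  have cross: "\<exists>u\<in>{p..q}. b u \<in> h k"
    if "2 \<le> k" "0 \<le> p" "p \<le> q" "b p \<in> A k" "b q \<in> B k" for k p q
  proof -
    have con: "connected (b ` {p..q})"
      by (rule connected_continuous_image[OF continuous_on_subset[OF continuous]]) (use that in auto)
    have "sides (h k) (A k) (B k)" using sides_at[of k] that by simp
    moreover have "b p \<in> b ` {p..q} \<inter> A k" "b q \<in> b ` {p..q} \<inter> B k" using that by auto
    ultimately have "b ` {p..q} \<inter> h k \<noteq> {}" using sides_cross[OF _ con] by blast
    then show ?thesis by blast
  qed
  have "b (t 1) \<in> A (j - 1)" "b (t j) \<in> B (j - 1)"
    using before_all[of 1 "j - 1"] after_all[of "j - 1" j] j t_in[of 1] t_in[of j] by auto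
  then obtain u0 where u0: "t 1 \<le> u0" "u0 \<le> t j" "b u0 \<in> h (j - 1)"
    using cross[of "j - 1" "t 1" "t j"] j tj t_nonneg[of 1] by auto
  obtain n where n: "j + 1 < n" "1 \<le> n" "t j \<le> t n" using ex_late .
  have "b (t j) \<in> A (j + 1)" "b (t n) \<in> B (j + 1)"
    using before_all[of j "j + 1"] after_all[of "j + 1" n] j n t_in[of n] t_in[of j] by auto
  then obtain u2 where u2: "t j \<le> u2" "b u2 \<in> h (j + 1)"
    using cross[of "j + 1" "t j" "t n"] j n t_nonneg[of j] by auto
  have "b (t j) \<in> h j" using t_in j by simp
  moreover have "h j \<inter> h (j - 1) = {}" "h j \<inter> h (j + 1) = {}"
    using chain_disjoint[of j "j - 1"] chain_disjoint[of j "j + 1"] j by auto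
  ultimately have ne: "u0 \<noteq> t j" "u2 \<noteq> t j" using u0 u2 by auto
  have sep: "L_separated (C * \<kappa> (t j)) (h (j - 1)) (h j)"
    "L_separated (C * \<kappa> (t (j + 1))) (h j) (h (j + 1))"
    using separated[of "j - 1"] separated[of j] j by auto
  \<comment> \<open>The detour through \<open>b (t j)\<close> is paid for once from \<open>x\<close>
    and once from \<open>y\<close>: \<open>2 * (2 * L + 4)\<close>.\<close>
  obtain w where w: "w \<in> c ` {0..dist x y}" "dist (b (t j)) w \<le> 2 * L + 4"
  proof (rule bottleneck[OF c _ _ _ _ _ _ u0(3) \<open>b (t j) \<in> h j\<close> u2(2) _ _ _ _ _ sep L])
    show "z (j - 1) \<in> c ` {0..dist x y}" "z (j - 1) \<in> h (j - 1)"
      "z j \<in> c ` {0..dist x y}" "z j \<in> h j"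
      "z (j + 1) \<in> c ` {0..dist x y}" "z (j + 1) \<in> h (j + 1)"
      using z[of "j - 1"] z[of j] z[of "j + 1"] by auto
    show "u0 < t j" "t j < u2" "u0 \<in> {0..}" "t j \<in> {0..}" "u2 \<in> {0..}"
      using u0(1,2) u2(1) ne tj t_nonneg[of 1] by auto
  qed
  have "dist x w + dist w y = dist x y" by (rule geodesic_joining_dist[OF c w(1)])
  then show ?thesis
    using w(2) dist_triangle[of x "b (t j)" w] dist_triangle[of y "b (t j)" w]
    by (simp add: dist_commute)
qed

text \<open>A step is bounded by \<open>\<kappa>\<close> at its new endpoint, which is not yet
  controlled. Beyond \<open>T0\<close> that bound is a tenth of the endpoint, so a step multiplies
  by at most \<open>10 / 9\<close>. Five steps stay below \<open>2 * \<tau>\<close>, and there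
  \<open>\<kappa>\<close> has at most doubled.\<close>

lemma t_bound:
  assumes T0: "\<And>v. T0 \<le> v \<Longrightarrow> 10 * C * \<kappa> v \<le> v" "0 < T0"
    and i: "1 \<le> i" "t i \<le> \<tau>" "\<And>k. i < k \<Longrightarrow> \<tau> < t k" and \<tau>: "T0 \<le> \<tau>"
    and n: "n \<le> 5"
  shows "t (i + int n) \<le> \<tau> * (10 / 9) ^ n" "t (i + int n) \<le> \<tau> + real n * (2 * C * \<kappa> \<tau>)"
    "\<kappa> (t (i + int n)) \<le> 2 * \<kappa> \<tau>"
proof -
  have "t (i + int n) \<le> \<tau> * (10 / 9) ^ n \<and> t (i + int n) \<le> \<tau> + real n * (2 * C * \<kappa> \<tau>) \<and>
      \<kappa> (t (i + int n)) \<le> 2 * \<kappa> \<tau>" using n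
  proof (induction n)
    case 0
    have "\<kappa> (t i) \<le> \<kappa> \<tau>" by (rule kappa_mono) (use i t_nonneg in auto)
    then show ?case using i kappa_ge_1[of \<tau>] \<tau> T0(2) by simp
  next
    case (Suc n)
    define u where "u = t (i + int (Suc n))"
    have u: "\<tau> < u" using i(3)[of "i + int (Suc n)"] by (simp add: u_def)
    have "i + int (Suc n) = (i + int n) + 1" by simp
    then have step: "u - t (i + int n) \<le> C * \<kappa> u"
      using t_step[of "i + int n"] i(1) by (simp only: u_def)
    have "10 * (C * \<kappa> u) \<le> u" using T0(1)[of u] u \<tau> by simp
    then have "u \<le> t (i + int n) * (10 / 9)" using step by simp
    also have "\<dots> \<le> \<tau> * (10 / 9) ^ n * (10 / 9)" using Suc by (intro mult_right_mono) auto
    finally have 1: "u \<le> \<tau> * (10 / 9) ^ Suc n" by simp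
    also have "\<dots> \<le> \<tau> * (10 / 9) ^ 5"
      using Suc.prems \<tau> T0(2) by (intro mult_left_mono power_increasing) auto
    also have "\<dots> \<le> 2 * \<tau>"
      using \<tau> T0(2) by (simp add: power_divide)
    finally have 2: "\<kappa> u \<le> 2 * \<kappa> \<tau>" using u \<tau> T0(2) by (intro kappa_le_double) auto
    then have "C * \<kappa> u \<le> C * (2 * \<kappa> \<tau>)" using C_pos by (intro mult_left_mono) auto
    then have "u \<le> \<tau> + real (Suc n) * (2 * C * \<kappa> \<tau>)"
      using step Suc by (simp add: algebra_simps)
    then show ?case using 1 2 by (simp add: u_def)
  qed
  then show "t (i + int n) \<le> \<tau> * (10 / 9) ^ n" "t (i + int n) \<le> \<tau> + real n * (2 * C * \<kappa> \<tau>)"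
    "\<kappa> (t (i + int n)) \<le> 2 * \<kappa> \<tau>" by auto
qed

text \<open>The contrapositive of contraction for a pair: when the feet are far apart, neither point
  lies in the ball around the other whose radius is the height of its centre.\<close>

lemma far_feet:
  assumes T0: "\<And>v. T0 \<le> v \<Longrightarrow> 10 * C * \<kappa> v \<le> v" "0 < T0"
    and T: "2 * T0 \<le> ft y"
    and far: "(36 * C + 24) * \<kappa> (ft y) < ft y - max (ft x) (t 1)"
  shows "height x < dist x y" "height y < dist x y"
proof -
  define s where "s = max (ft x) (t 1)"
  define \<tau> where "\<tau> = (s + ft y) / 2"
  have s: "ft x \<le> s" "t 1 \<le> s" "0 \<le> s" using t_nonneg[of 1] by (auto simp: s_def)
  have y0: "0 \<le> ft y" by (rule ft_nonneg)
  have "0 \<le> (36 * C + 24) * \<kappa> (ft y)" using C_pos kappa_ge_1[OF y0] by simp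
  then have sy: "s < ft y" using far unfolding s_def by linarith
  have two: "2 * \<tau> = s + ft y" by (simp add: \<tau>_def)
  have \<tau>: "s < \<tau>" "\<tau> < ft y" "T0 \<le> \<tau>" "0 \<le> \<tau>"
    using sy two T s T0(2) by linarith+
  define N where "N = C * \<kappa> \<tau>"
  have "\<kappa> \<tau> \<le> \<kappa> (ft y)" using \<tau> by (intro kappa_mono) auto
  then have "(36 * C + 24) * \<kappa> \<tau> \<le> (36 * C + 24) * \<kappa> (ft y)"
    using C_pos by (intro mult_left_mono) auto
  moreover have "1 \<le> \<kappa> \<tau>" by (rule kappa_ge_1[OF \<tau>(4)])
  ultimately have "36 * N + 24 < ft y - s"
    using far by (simp add: N_def s_def algebra_simps)
  \<comment> \<open>The curtains used have parameters between \<open>\<tau>\<close> and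
    \<open>\<tau> + 10 * N\<close>. On the side of \<open>y\<close> this leaves
    \<open>8 * N + 12\<close>, just more than the error \<open>8 * N + 8\<close> in
    \<open>near\<close>.\<close>
  then have gap: "18 * N + 12 < \<tau> - s" "18 * N + 12 < ft y - \<tau>" using two by linarith+
  have N: "0 \<le> N" using C_pos \<open>1 \<le> \<kappa> \<tau>\<close> by (simp add: N_def)
  obtain i where i: "1 \<le> i" "t i \<le> \<tau>" "\<And>k. i < k \<Longrightarrow> \<tau> < t k"
    using ex_last[of \<tau>] s \<tau> by auto
  have tk: "\<tau> < t k" "t k \<le> \<tau> + 10 * N" "C * \<kappa> (t k) \<le> 2 * N" if k: "k \<in> {i + 1..i + 5}" for k
  proof -
    define n where "n = nat (k - i)"
    have n: "k = i + int n" "n \<le> 5" "i < k" using k by (auto simp: n_def)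
    show "\<tau> < t k" by (rule i(3)[OF n(3)])
    have "t k \<le> \<tau> + real n * (2 * N)"
      using t_bound(2)[OF T0 i \<tau>(3) n(2)] n(1) by (simp add: N_def mult.assoc)
    also have "real n * (2 * N) \<le> 5 * (2 * N)" using n N by (intro mult_right_mono) auto
    finally show "t k \<le> \<tau> + 10 * N" by simp
    have "\<kappa> (t k) \<le> 2 * \<kappa> \<tau>" using t_bound(3)[OF T0 i \<tau>(3) n(2)] n(1) by simp
    then have "C * \<kappa> (t k) \<le> C * (2 * \<kappa> \<tau>)" using C_pos by (intro mult_left_mono) auto
    then show "C * \<kappa> (t k) \<le> 2 * N" by (simp add: N_def)
  qed
  have e: "i + 1 + 1 = i + 2" "i + 4 + 1 = i + 5" by auto
  \<comment> \<open>Of the five curtains after \<open>\<tau>\<close>, the first two confine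
    \<open>x\<close> and the last two confine \<open>y\<close>; the middle three are then crossed by
    the geodesic from \<open>x\<close> to \<open>y\<close>.\<close>
  have xA: "x \<in> A (i + 2)"
    using in_A[of "i + 1" x s \<tau> "2 * N", unfolded e] i(1) s tk[of "i + 1"] tk[of "i + 2"] gap N by simp
  have yB: "y \<in> B (i + 4)"
    using in_B[of "i + 4" "ft y" y "\<tau> + 10 * N" "2 * N", unfolded e] i(1) \<tau> tk[of "i + 4"] tk[of "i + 5"] gap N
    by simp
  define j where "j = i + 3"
  have xy: "x \<in> A k \<and> y \<in> B k" if "k \<in> {j - 1..j + 1}" for k
  proof -
    have "k = i + 2 \<or> k = i + 3 \<or> k = i + 4" using that by (auto simp: j_def)
    then show ?thesis
      using xA yB A_subset[of "i + 2" k] B_subset[of k "i + 4"] i(1) by auto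
  qed
  have j: "3 \<le> j" "j \<in> {i + 1..i + 5}" "j + 1 \<in> {i + 1..i + 5}" using i(1) by (auto simp: j_def)
  note tj = tk(1,2)[OF j(2)]
  have near: "dist x (b (t j)) + dist y (b (t j)) \<le> dist x y + 4 * (2 * N) + 8"
    by (rule geodesic_near_ray[OF j(1) _ xy tk(3)[OF j(2)] tk(3)[OF j(3)]]) (use s \<tau> tj in auto)
  have ftj: "ft (b (t j)) = t j" using tj \<tau> by (simp add: foot_self)
  have "\<bar>ft x - t j\<bar> \<le> dist x (b (t j))" "\<bar>ft y - t j\<bar> \<le> dist y (b (t j))"
    using foot_lipschitz[of x "b (t j)"] foot_lipschitz[of y "b (t j)"] ftj by auto
  moreover have "height x \<le> dist x (b (t j))" "height y \<le> dist y (b (t j))"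
    using tj \<tau> by (auto intro: foot_le)
  ultimately show "height x < dist x y" "height y < dist x y"
    using near gap tj s(1) N by linarith+
qed

lemma chain_imp_contracting: "contracting (b 0) \<kappa> b"
proof -
  obtain T0 where T0: "0 < T0" "\<And>v. T0 \<le> v \<Longrightarrow> 10 * C * \<kappa> v \<le> v"
    using kappa_eventually_le[of "10 * C"] C_pos by auto
  \<comment> \<open>The constant of \<open>far_feet\<close>, enlarged by
    \<open>t 1 + 2 * T0\<close>: as \<open>\<kappa>\<close> is at least 1, this handles feet near
    the start of the ray.\<close>
  define Q where "Q = 36 * C + 24 + t 1 + 2 * T0"
  have Q: "0 \<le> Q" using C_pos T0 t_nonneg[of 1] by (simp add: Q_def)
  have aux: "ft y - ft x \<le> Q * \<kappa> (ft y)"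
    if "dist x y < height x \<or> dist x y < height y" for x y
  proof (rule ccontr)
    assume "\<not> ?thesis"
    then have far: "Q * \<kappa> (ft y) < ft y - ft x" by simp
    have k: "1 \<le> \<kappa> (ft y)" by (rule kappa_ge_1[OF ft_nonneg])
    have "t 1 \<le> t 1 * \<kappa> (ft y)" "2 * T0 \<le> 2 * T0 * \<kappa> (ft y)"
      using mult_left_mono[OF k, of "t 1"] mult_left_mono[OF k, of "2 * T0"] T0(1) t_nonneg[of 1]
      by auto
    then have Qk: "(36 * C + 24) * \<kappa> (ft y) + t 1 + 2 * T0 \<le> Q * \<kappa> (ft y)"
      by (simp add: Q_def algebra_simps)
    have "0 \<le> (36 * C + 24) * \<kappa> (ft y)" using C_pos k by simp
    then have "2 * T0 \<le> ft y" "(36 * C + 24) * \<kappa> (ft y) < ft y - max (ft x) (t 1)"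
      using far Qk T0(1) t_nonneg[of 1] ft_nonneg[of x] by (auto simp: max_def)
    then show False using far_feet[OF T0(2,1), of y x] that by auto
  qed
  have close: "\<bar>ft x - ft y\<bar> \<le> 2 * Q * \<kappa> (dist (b 0) x)" if y: "dist x y < height x" for x y
  proof -
    have ft0: "ft (b 0) = 0" by (simp add: foot_self)
    have "ft x \<le> dist (b 0) x" using foot_lipschitz[of "b 0" x] ft0 by linarith
    moreover have "height x \<le> dist (b 0) x" using foot_le[of 0 x] by (simp add: dist_commute)
    ultimately have le: "ft x \<le> 2 * dist (b 0) x" "ft y \<le> 2 * dist (b 0) x"
      using foot_lipschitz[of x y] y by (auto simp: dist_commute)
    \<comment> \<open>\<open>aux\<close> measures by \<open>\<kappa>\<close> at a foot, whereas
      contraction measures at the distance from \<open>b 0\<close> to the centre.\<close>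
    have "Q * \<kappa> (ft z) \<le> 2 * Q * \<kappa> (dist (b 0) x)" if "ft z \<le> 2 * dist (b 0) x" for z
      using mult_left_mono[OF kappa_le_double[OF zero_le_dist ft_nonneg that] Q] by simp
    then show ?thesis
      using aux[of x y] aux[of y x] y le by (fastforce simp: dist_commute abs_le_iff)
  qed
  show ?thesis
    unfolding contracting_def
  \<comment> \<open>Two points of the projection are each within \<open>2 * Q\<close> times
    \<open>\<kappa>\<close> of that of the centre; the summand 1 makes the inequality
    strict.\<close>
  proof (intro exI[of _ "4 * Q + 1"] conjI allI impI)
    fix x and \<rho> :: real assume \<rho>: "0 < \<rho>" "ball x \<rho> \<inter> b ` {0..} = {}"
    have "b (ft x) \<notin> ball x \<rho>" using \<rho>(2) foot_in[of x] by blast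
    then have "\<rho> \<le> height x" by simp
    then have y: "\<bar>ft x - ft y\<bar> \<le> 2 * Q * \<kappa> (dist (b 0) x)" if "y \<in> ball x \<rho>" for y
      using that by (intro close) auto
    let ?P = "closest_proj (b ` {0..}) ` ball x \<rho>"
    have "?P \<noteq> {}" using \<rho> by simp
    have le: "dist p q \<le> 4 * Q * \<kappa> (dist (b 0) x)" if pq: "p \<in> ?P" "q \<in> ?P" for p q
    proof -
      obtain v w where "v \<in> ball x \<rho>" "w \<in> ball x \<rho>" "p = b (ft v)" "q = b (ft w)"
        using pq by (auto simp: closest_proj_eq)
      then show ?thesis
        using y[of v] y[of w] dist_geodesic[OF foot_in[of v] foot_in[of w]] by simp
    qed
    have "diameter ?P = (SUP (p, q)\<in>?P \<times> ?P. dist p q)"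
      using \<open>?P \<noteq> {}\<close> by (simp only: diameter_def if_False)
    also have "\<dots> \<le> 4 * Q * \<kappa> (dist (b 0) x)"
    proof (rule cSUP_least)
      show "?P \<times> ?P \<noteq> {}" using \<open>?P \<noteq> {}\<close> by blast
      fix z assume "z \<in> ?P \<times> ?P"
      then show "(case z of (p, q) \<Rightarrow> dist p q) \<le> 4 * Q * \<kappa> (dist (b 0) x)"
        using le[of "fst z" "snd z"] by (simp only: split_beta mem_Times_iff)
    qed
    also have "\<dots> < (4 * Q + 1) * \<kappa> (dist (b 0) x)"
      using kappa_ge_1[of "dist (b 0) x"] by (simp add: algebra_simps)
    finally show "diameter (closest_proj (b ` {0..}) ` ball x \<rho>) < (4 * Q + 1) * \<kappa> (dist (b 0) x)" .
  qed (use Q in simp)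
qed

end

theorem theoremC:
  fixes o' :: "'a::cat0_space"
    and \<kappa> :: "real \<Rightarrow> real"
    and b :: "real \<Rightarrow> 'a"
  assumes "sublinear_fun \<kappa>"
    and "geodesic_on {0..} b" and "b 0 = o'"
  shows "contracting o' \<kappa> b \<longleftrightarrow>
    (\<exists>C>0. \<exists>(h :: int \<Rightarrow> 'a set) (t :: int \<Rightarrow> real).
       curtain_chain {1..} h \<and>
       (\<forall>i\<ge>1. 0 \<le> t i \<and> b (t i) \<in> h i \<and>
          t (i + 1) - t i \<le> C * \<kappa> (t (i + 1)) \<and>
          L_separated (C * \<kappa> (t (i + 1))) (h i) (h (i + 1))))" (is "_ \<longleftrightarrow> ?chain")
proof -
  interpret cat0_ray \<kappa> b by standard (use assms in auto)
  have "contracting (b 0) \<kappa> b" if ?chain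
  proof -
    obtain C h t where C: "C > 0" "curtain_chain {1..} h"
      and t: "\<forall>i\<ge>1. 0 \<le> t i \<and> b (t i) \<in> h i \<and> t (i + 1) - t i \<le> C * \<kappa> (t (i + 1)) \<and>
          L_separated (C * \<kappa> (t (i + 1))) (h i) (h (i + 1))"
      using \<open>?chain\<close> by blast
    obtain A B where "curtain_chain_sides {1..} h A B" using curtain_chain_sidesE[OF C(2)] .
    then interpret curtain_chain_sides "{1..}" h A B .
    interpret ray_with_chain \<kappa> b h A B C t by standard (use C t in auto)
    show ?thesis by (rule chain_imp_contracting)
  qed
  then show ?thesis using contracting_imp_chain assms(3) by blast
qed

end
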